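(* Let $n$ and $k$ be integers with $2\le k\le n-1$ such that $\mathscr{G}_n^k\setminus\{K_n^k\}$ is nonempty. Then the second last graph in the $S$-order among $\mathscr{G}_n^k$ is uniquely $H$, where $H=G_3$ if $k\in\{2,3,\dots,n-2\}$ and $H=K_{1,n-1}^*$ if $k=n-1$. That is, $H\in\mathscr{G}_n^k$, $H\prec_s K_n^k$, and $G\prec_s H$ for every $G\in\mathscr{G}_n^k$ isomorphic to neither $K_n^k$ nor $H$.
   Context: All graphs are finite, simple, undirected and connected. A cut edge of a connected graph is an edge whose deletion breaks the graph into two components. $\mathscr{G}_n^k$ is the set of all connected $n$-vertex graphs with exactly $k$ cut edges (graphs are considered up to isomorphism). For an $n$-vertex graph $G$ with adjacency eigenvalues $\lambda_1(G)\ge\dots\ge\lambda_n(G)$, the $i$th spectral moment is $S_i(G)=\sum_{j=1}^n\lambda_j(G)^i$ for $i=0,1,\dots,n-1$. For two $n$-vertex graphs $G_1,G_2$, write $G_1\prec_s G_2$ ($G_1$ comes before $G_2$ in the $S$-order) if for some $j\in\{1,\dots,n-1\}$ we have $S_i(G_1)=S_i(G_2)$ for $i=0,1,\dots,j-1$ and $S_j(G_1)<S_j(G_2)$. $K_m$ is the complete graph on $m$ vertices. $K_n^k$ is the $n$-vertex graph obtained by attaching $k$ pendant vertices to one vertex of $K_{n-k}$ (so $K_n^{n-1}$ is the star $K_{1,n-1}$); it is the last graph in the $S$-order among $\mathscr{G}_n^k$. $G_3$ is the $n$-vertex graph obtained from $K_n^k$ as follows: let $u$ be the vertex of the clique $K_{n-k}$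 to which the $k$ pendant vertices are attached, let $uw$ be one of the $k$ pendant edges, and let $v\ne u$ be another vertex of $K_{n-k}$; then $G_3=K_n^k-uw+vw$. $K_{1,n-1}^*$ is the $n$-vertex tree obtained from the star $K_{1,n-2}$ by attaching a leaf to one leaf of $K_{1,n-2}$.
   Formalization: The pair n=4, k=3 is excluded: there the class is {K_{1,3}, P_4}, both graphs have S_0,...,S_3 = 4,0,6,0, and the S-order only compares moments up to S_{n-1}=S_3, so K_{1,3}^* does not come before K_4^3 and the claim fails. *)

theory Defs
  imports
    "Graph_Theory.Graph_Theory"
    "Jordan_Normal_Form.Char_Poly"
    Complex_Main
begin

text \<open>
  A finite simple undirected graph is a value satisfying \<open>pair_graph\<close>, where an undirected edge
  \<open>uv\<close> is the pair of opposite arcs \<open>(u,v)\<close> and \<open>(v,u)\<close>. The \<open>n\<close>-vertex graphs are represented,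
  up to isomorphism, by those with vertex set \<open>{..<n}\<close>.
\<close>

definition graph_on :: "nat set \<Rightarrow> (nat \<times> nat) set \<Rightarrow> nat pair_pre_digraph" where
  "graph_on V E = \<lparr>pverts = V, parcs = E \<union> E\<inverse>\<rparr>"

definition del_edge :: "'a \<Rightarrow> 'a \<Rightarrow> 'a pair_pre_digraph \<Rightarrow> 'a pair_pre_digraph" where
  "del_edge u v G = \<lparr>pverts = pverts G, parcs = parcs G - {(u, v), (v, u)}\<rparr>"

definition add_edge :: "'a \<Rightarrow> 'a \<Rightarrow> 'a pair_pre_digraph \<Rightarrow> 'a pair_pre_digraph" where
  "add_edge u v G = \<lparr>pverts = pverts G, parcs = parcs G \<union> {(u, v), (v, u)}\<rparr>"

definition attach_leaf :: "'a \<Rightarrow> 'a \<Rightarrow> 'a pair_pre_digraph \<Rightarrow> 'a pair_pre_digraph" where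
  "attach_leaf u w G = \<lparr>pverts = insert w (pverts G), parcs = parcs G \<union> {(u, w), (w, u)}\<rparr>"

abbreviation isomorphic :: "'a pair_pre_digraph \<Rightarrow> 'b pair_pre_digraph \<Rightarrow> bool" where
  "isomorphic G H \<equiv> digraph_iso (with_proj G) (with_proj H)"

text \<open>
  The strongly connected components of a symmetric digraph are the connected components of the
  underlying undirected graph.
\<close>

definition cut_edges :: "'a pair_pre_digraph \<Rightarrow> 'a set set" where
  "cut_edges G = {{u, v} | u v. (u, v) \<in> parcs G \<and>
     card (pre_digraph.sccs (with_proj (del_edge u v G))) = 2}"

definition graphs_with_cut_edges :: "nat \<Rightarrow> nat \<Rightarrow> nat pair_pre_digraph set" where
  "graphs_with_cut_edges n k =
     {G. pair_graph G \<and> pverts G = {..<n} \<and>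
         Digraph_Component.connected (with_proj G) \<and> card (cut_edges G) = k}"

text \<open>
  The adjacency matrix presupposes the vertex set \<open>{..<n}\<close>. It is then real symmetric, so its
  characteristic polynomial splits over the reals and the multiset of eigenvalues has size \<open>n\<close>.
\<close>

definition adjacency_matrix :: "nat pair_pre_digraph \<Rightarrow> real mat" where
  "adjacency_matrix G = mat (card (pverts G)) (card (pverts G))
     (\<lambda>(i, j). if (i, j) \<in> parcs G then 1 else 0)"

definition adjacency_eigenvalues :: "nat pair_pre_digraph \<Rightarrow> real multiset" where
  "adjacency_eigenvalues G = proots (char_poly (adjacency_matrix G))"

definition spectral_moment :: "nat \<Rightarrow> nat pair_pre_digraph \<Rightarrow> real" where
  "spectral_moment i G = (\<Sum>x\<in>#adjacency_eigenvalues G. x ^ i)"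

definition S_before :: "nat pair_pre_digraph \<Rightarrow> nat pair_pre_digraph \<Rightarrow> bool" (infix "\<prec>\<^sub>s" 50) where
  "G \<prec>\<^sub>s H \<longleftrightarrow> card (pverts G) = card (pverts H) \<and>
     (\<exists>j\<in>{1..card (pverts G) - 1}.
        (\<forall>i<j. spectral_moment i G = spectral_moment i H) \<and>
        spectral_moment j G < spectral_moment j H)"

text \<open>
  In \<open>clique_pendants n k\<close>, which is $K_n^k$, the clique is \<open>{..<n - k}\<close> and the \<open>k\<close> pendant
  vertices \<open>{n - k..<n}\<close> are attached to the clique vertex \<open>0\<close>.
\<close>

definition clique_pendants :: "nat \<Rightarrow> nat \<Rightarrow> nat pair_pre_digraph" where
  "clique_pendants n k = graph_on {..<n}
     ({(i, j). i < n - k \<and> j < n - k \<and> i \<noteq> j} \<union> {0} \<times> {n - k..<n})"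

text \<open>$G_3 = K_n^k - uw + vw$ with \<open>u = 0\<close>, \<open>v = 1\<close>, \<open>w = n - 1\<close>.\<close>

definition clique_pendants_moved :: "nat \<Rightarrow> nat \<Rightarrow> nat pair_pre_digraph" where
  "clique_pendants_moved n k = add_edge 1 (n - 1) (del_edge 0 (n - 1) (clique_pendants n k))"

definition star :: "nat \<Rightarrow> nat pair_pre_digraph" where
  "star m = graph_on {..m} ({0} \<times> {1..m})"

text \<open>$K_{1,n-1}^*$: a leaf attached to the leaf \<open>1\<close> of $K_{1,n-2}$.\<close>

definition extended_star :: "nat \<Rightarrow> nat pair_pre_digraph" where
  "extended_star n = attach_leaf 1 (n - 1) (star (n - 2))"

definition second_last :: "nat \<Rightarrow> nat \<Rightarrow> nat pair_pre_digraph" where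
  "second_last n k = (if k = n - 1 then extended_star n else clique_pendants_moved n k)"

end

theory Submission
  imports Defs "Jordan_Normal_Form.Schur_Decomposition"
begin

text \<open>
  Spectral moments count closed walks, so \<open>S\<^sub>0\<close> and \<open>S\<^sub>1\<close> only see the order, \<open>S\<^sub>2\<close> the number of
  edges, \<open>S\<^sub>3\<close> the triangles, and \<open>S\<^sub>4\<close> is determined by the edges, the 4-cycles and the sum of
  squared degrees. Deleting the \<open>k\<close> cut edges leaves \<open>k + 1\<close> components, hence by convexity at most
  \<open>m (m - 1) / 2 + k\<close> edges where \<open>m = n - k\<close>, with equality only for trees hanging off a clique on
  \<open>m\<close> vertices. Such graphs share \<open>S\<^sub>0, \<dots>, S\<^sub>3\<close> and all their 4-cycles lie in the clique, so
  \<open>S\<^sub>4\<close> compares their sums of squared degrees. Orienting the cut edges away from the clique, this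
  sum is a function of the numbers of children, which is largest when one clique vertex has all
  the children and second largest when exactly one pendant vertex is moved. For trees, \<open>m = 1\<close>,
  any vertex can serve as the clique, and the comparison needs one of maximal degree.
\<close>

section \<open>Spectral moments and closed walks\<close>

text \<open>The order compares moments only up to \<open>n - 1\<close>, so a decision by S_4 needs
  five vertices. Below that, the only pair with a competitor is \<open>n = 4\<close>,
  \<open>k = 3\<close>: the path and the star on four vertices agree on S_0, ..., S_3, so neither
  precedes the other, and the theorem excludes this pair. The other degenerate value is
  \<open>k = n - 2\<close>: exactly one edge would fail to be a cut edge, which is impossible, so
  the class is empty and the existence assumption rules it out.

  The linear part of the sum of squared degrees pulls in opposite directions for cliques and trees.
  A child of a clique vertex contributes 2(m - 1), a child of any other vertex 2. For m \<ge> 3,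
  hanging children deeper loses on this part. For m = 1 it gains, and only the squares of the child
  counts can compensate; rooting at maximal degree bounds them, because every other vertex then has
  strictly fewer children than the root.

  Edges are counted as pairs of opposite arcs and cycles as ordered tuples.\<close>

definition mat_trace :: "'a::comm_ring_1 mat \<Rightarrow> 'a" where
  "mat_trace A = (\<Sum>i<dim_row A. A $$ (i, i))"

lemma mat_trace_mult_commute:
  assumes "A \<in> carrier_mat n m" "B \<in> carrier_mat m n"
  shows "mat_trace (A * B) = mat_trace (B * A)"
proof -
  have "mat_trace (A * B) = (\<Sum>i<n. \<Sum>j<m. A $$ (i, j) * B $$ (j, i))"
    using assms by (auto simp: mat_trace_def scalar_prod_def atLeast0LessThan intro!: sum.cong)
  also have "\<dots> = (\<Sum>j<m. \<Sum>i<n. B $$ (j, i) * A $$ (i, j))"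
    by (subst sum.swap) (simp add: mult.commute)
  also have "\<dots> = mat_trace (B * A)"
    using assms by (auto simp: mat_trace_def scalar_prod_def atLeast0LessThan intro!: sum.cong)
  finally show ?thesis .
qed

lemma mat_trace_similar:
  assumes "similar_mat_wit A B P Q"
  shows "mat_trace A = mat_trace B"
proof -
  define n where "n = dim_row A"
  note w = similar_mat_witD[OF n_def assms]
  have "mat_trace A = mat_trace (P * (B * Q))"
    using w by (simp add: assoc_mult_mat[of _ n n _ n _ n])
  also have "\<dots> = mat_trace ((B * Q) * P)"
    using w by (intro mat_trace_mult_commute[of _ n n]) auto
  also have "(B * Q) * P = B"
    using w by (simp add: assoc_mult_mat[of _ n n _ n _ n])
  finally show ?thesis .
qed

text \<open>Nothing is claimed above the diagonal: on and below it the product sum collapses to the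
  term \<open>l = i\<close>, and the trace needs no more.\<close>

lemma upper_triangular_pow:
  fixes B :: "'a::comm_ring_1 mat"
  assumes B: "B \<in> carrier_mat n n" and ut: "upper_triangular B"
  shows "i < n \<Longrightarrow> j < n \<Longrightarrow> j \<le> i \<Longrightarrow>
    (B ^\<^sub>m k) $$ (i, j) = (if i = j then (B $$ (i, i)) ^ k else 0)"
proof (induction k arbitrary: i j)
  case 0
  then show ?case using B by auto
next
  case (Suc k)
  have car: "B ^\<^sub>m k \<in> carrier_mat n n" using B by auto
  have "(B ^\<^sub>m Suc k) $$ (i, j) = (\<Sum>l<n. (B ^\<^sub>m k) $$ (i, l) * B $$ (l, j))"
    using Suc.prems B car by (auto simp: scalar_prod_def atLeast0LessThan intro!: sum.cong)
  also have "\<dots> = (\<Sum>l<n. if l = i then (B ^\<^sub>m k) $$ (i, i) * B $$ (i, j) else 0)"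
  proof (intro sum.cong refl)
    fix l assume "l \<in> {..<n}"
    then have l: "l < n" by simp
    consider "l = i" | "l < i" | "i < l" by linarith
    then show "(B ^\<^sub>m k) $$ (i, l) * B $$ (l, j) =
        (if l = i then (B ^\<^sub>m k) $$ (i, i) * B $$ (i, j) else 0)"
    proof cases
      case 2
      then show ?thesis using Suc.IH[of i l] Suc.prems l by simp
    next
      case 3
      then have "B $$ (l, j) = 0" using upper_triangularD[OF ut, of j l] Suc.prems l B by auto
      then show ?thesis using 3 by simp
    qed simp
  qed
  also have "\<dots> = (B $$ (i, i)) ^ k * B $$ (i, j)"
    using Suc.prems Suc.IH[of i i] by simp
  also have "\<dots> = (if i = j then (B $$ (i, i)) ^ Suc k else 0)"
    using upper_triangularD[OF ut, of j i] Suc.prems B by auto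
  finally show ?case .
qed

text \<open>The sum of \<open>A $$ (i, j) * v $ j * cnj (v $ i)\<close> equals \<open>e * s\<close>
  when summed by rows and, \<open>A\<close> being real and symmetric, \<open>cnj e * s\<close> when
  summed by columns; \<open>s\<close> is the squared norm of \<open>v\<close>.\<close>

lemma eigenvalue_symmetric_real:
  fixes A :: "real mat" and e :: complex
  assumes A: "A \<in> carrier_mat n n" and sym: "transpose_mat A = A"
    and e: "eigenvalue (map_mat of_real A) e"
  shows "cnj e = e"
proof -
  let ?A = "map_mat of_real A :: complex mat"
  have cA: "?A \<in> carrier_mat n n" using A by auto
  obtain v where v: "v \<in> carrier_vec n" "v \<noteq> 0\<^sub>v n" "?A *\<^sub>v v = e \<cdot>\<^sub>v v"
    using e A unfolding eigenvalue_def eigenvector_def by auto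
  have sA: "A $$ (i, j) = A $$ (j, i)" if "i < n" "j < n" for i j
    using that A arg_cong[OF sym, of "\<lambda>M. M $$ (i, j)"] by simp
  have ev: "(\<Sum>j<n. of_real (A $$ (i, j)) * v $ j) = e * v $ i" if "i < n" for i
    using arg_cong[OF v(3), of "\<lambda>w. w $ i"] that v(1) A
    by (auto simp: scalar_prod_def atLeast0LessThan)
  define s where "s = (\<Sum>i<n. v $ i * cnj (v $ i))"
  have "e * s = (\<Sum>i<n. (\<Sum>j<n. of_real (A $$ (i, j)) * v $ j) * cnj (v $ i))"
    by (auto simp: s_def sum_distrib_left ev mult.assoc intro!: sum.cong)
  also have "\<dots> = (\<Sum>i<n. \<Sum>j<n. of_real (A $$ (i, j)) * v $ j * cnj (v $ i))"
    by (simp add: sum_distrib_right)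
  also have "\<dots> = (\<Sum>j<n. \<Sum>i<n. of_real (A $$ (i, j)) * v $ j * cnj (v $ i))"
    by (rule sum.swap)
  also have "\<dots> = (\<Sum>j<n. v $ j * cnj (\<Sum>i<n. of_real (A $$ (j, i)) * v $ i))"
    by (auto simp: sum_distrib_left sA mult_ac intro!: sum.cong)
  also have "\<dots> = cnj e * s"
    unfolding s_def sum_distrib_left by (intro sum.cong refl) (subst ev, simp_all)
  finally have "e * s = cnj e * s" .
  moreover have "s \<noteq> 0"
  proof -
    obtain i where i: "i < n" "v $ i \<noteq> 0"
      using v(1,2) by (metis carrier_vecD eq_vecI index_zero_vec(1,2))
    have "s = of_real (\<Sum>i<n. (cmod (v $ i))\<^sup>2)"
      by (simp add: s_def flip: complex_norm_square)
    moreover have "(\<Sum>i<n. (cmod (v $ i))\<^sup>2) > 0"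
      using i by (intro sum_pos2[of _ i]) auto
    ultimately show ?thesis by (simp only: of_real_eq_0_iff)
  qed
  ultimately show ?thesis by simp
qed

text \<open>Eigenvalues are collected as real roots, so the complex factorisation must come down to
  the reals: its roots are real, and embedding real polynomials into complex ones is
  injective.\<close>

lemma char_poly_symmetric_splits:
  fixes A :: "real mat"
  assumes A: "A \<in> carrier_mat n n" and sym: "transpose_mat A = A"
  shows "\<exists>es. char_poly A = (\<Prod>e\<leftarrow>es. [:- e, 1:])"
proof -
  interpret h: map_poly_inj_idom_hom "of_real :: real \<Rightarrow> complex" ..
  let ?A = "map_mat of_real A :: complex mat"
  have cA: "?A \<in> carrier_mat n n" using A by auto
  from char_poly_factorized[OF cA] obtain as where
    as: "char_poly ?A = (\<Prod>a\<leftarrow>as. [:- a, 1:])" by blast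
  have real: "of_real (Re a) = a" if "a \<in> set as" for a
  proof -
    have "poly (char_poly ?A) a = 0"
      using that unfolding as by (induction as) auto
    then have "eigenvalue ?A a" using eigenvalue_root_char_poly[OF cA] by simp
    from eigenvalue_symmetric_real[OF A sym this] show ?thesis
      by (simp add: complex_eq_iff)
  qed
  have "map_poly of_real (char_poly A) = char_poly ?A"
    by (rule of_real_hom.char_poly_hom[OF A, symmetric])
  also have "\<dots> = (\<Prod>a\<leftarrow>map (\<lambda>a. of_real (Re a)) as. [:- a, 1:])"
    unfolding as using real by (simp add: comp_def cong: map_cong)
  also have "\<dots> = map_poly of_real (\<Prod>a\<leftarrow>map Re as. [:- a, 1:])"
    by (simp add: h.hom_prod_list of_real_hom.map_poly_pCons_hom comp_def)
  finally have "map_poly (of_real :: real \<Rightarrow> complex) (char_poly A) =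
    map_poly of_real (\<Prod>a\<leftarrow>map Re as. [:- a, 1:])" .
  then have "char_poly A = (\<Prod>a\<leftarrow>map Re as. [:- a, 1:])"
    by simp
  then show ?thesis by blast
qed

text \<open>Schur decomposition gives a similar triangular matrix whose diagonal lists the roots
  with multiplicity; its powers have the powers of the roots on the diagonal.\<close>

lemma power_sum_eigenvalues_eq_trace:
  fixes A :: "real mat"
  assumes A: "A \<in> carrier_mat n n" and sym: "transpose_mat A = A"
  shows "(\<Sum>x\<in>#proots (char_poly A). x ^ k) = mat_trace (A ^\<^sub>m k)"
proof -
  obtain es where es: "char_poly A = (\<Prod>e\<leftarrow>es. [:- e, 1:])"
    using char_poly_symmetric_splits[OF A sym] by blast
  obtain B P Q where "schur_decomposition A es = (B, P, Q)"
    by (cases "schur_decomposition A es") auto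
  from schur_decomposition[OF A es this] have
    sim: "similar_mat_wit A B P Q" and ut: "upper_triangular B" and diag: "diag_mat B = es"
    by auto
  have B: "B \<in> carrier_mat n n" using similar_mat_witD2[OF A sim] by auto
  have "proots (char_poly A) = mset es"
    unfolding es
  proof (induction es)
    case (Cons e es)
    have "(\<Prod>e\<leftarrow>es. [:- e, 1:]) \<noteq> 0" by (auto simp: prod_list_zero_iff)
    moreover have "proots [:- e, 1:] = {#e#}"
      by (intro multiset_eqI) (auto simp: order_linear')
    ultimately show ?case using Cons by (simp add: proots_mult del: mult_pCons_left)
  qed simp
  then have "(\<Sum>x\<in>#proots (char_poly A). x ^ k) = (\<Sum>x\<leftarrow>es. x ^ k)"
    by (simp flip: mset_map sum_mset_sum_list)
  also have "\<dots> = (\<Sum>i<n. (B $$ (i, i)) ^ k)"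
    using B by (simp add: diag[symmetric] diag_mat_def comp_def interv_sum_list_conv_sum_set_nat
        atLeast0LessThan)
  also have "\<dots> = mat_trace (B ^\<^sub>m k)"
    using B upper_triangular_pow[OF B ut] by (simp add: mat_trace_def)
  also have "\<dots> = mat_trace (A ^\<^sub>m k)"
    using mat_trace_similar[OF similar_mat_wit_pow[OF sim]] by simp
  finally show ?thesis .
qed

section \<open>The first moments as counts of closed walks\<close>

definition simple_rel :: "'a set \<Rightarrow> 'a rel \<Rightarrow> bool" where
  "simple_rel V E \<longleftrightarrow> finite V \<and> E \<subseteq> V \<times> V \<and> sym E \<and> irrefl E"

definition closed_walks3 :: "'a rel \<Rightarrow> ('a \<times> 'a \<times> 'a) set" where
  "closed_walks3 E = {(a, b, c). (a, b) \<in> E \<and> (b, c) \<in> E \<and> (c, a) \<in> E}"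

definition closed_walks4 :: "'a rel \<Rightarrow> ('a \<times> 'a \<times> 'a \<times> 'a) set" where
  "closed_walks4 E = {(a, b, c, d). (a, b) \<in> E \<and> (b, c) \<in> E \<and> (c, d) \<in> E \<and> (d, a) \<in> E}"

text \<open>Irreflexivity supplies the remaining inequalities, so in a simple graph every 4-cycle is
  counted eight times: four starting points, two directions.\<close>

definition four_cycles :: "'a rel \<Rightarrow> ('a \<times> 'a \<times> 'a \<times> 'a) set" where
  "four_cycles E = {(a, b, c, d) \<in> closed_walks4 E. a \<noteq> c \<and> b \<noteq> d}"

abbreviation deg :: "'a rel \<Rightarrow> 'a \<Rightarrow> nat" where
  "deg E v \<equiv> card (E `` {v})"

lemma of_nat_card_filter:
  assumes "finite S" "X = {x \<in> S. P x}"
  shows "of_nat (card X) = (\<Sum>x\<in>S. of_bool (P x) :: real)"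
  using assms by (simp add: sum.If_cases of_bool_def Int_def)

context
  fixes n :: nat and G :: "nat pair_pre_digraph" and E :: "nat rel"
  assumes V: "pverts G = {..<n}" and E: "parcs G = E" and simple: "simple_rel {..<n} E"
begin

private abbreviation "A \<equiv> adjacency_matrix G"
private abbreviation e :: "nat \<Rightarrow> nat \<Rightarrow> real" where "e i j \<equiv> of_bool ((i, j) \<in> E)"

private lemma carrier: "A \<in> carrier_mat n n"
  by (simp add: adjacency_matrix_def V)

private lemma entry: "i < n \<Longrightarrow> j < n \<Longrightarrow> A $$ (i, j) = e i j"
  by (simp add: adjacency_matrix_def V E)

private lemma entry_Suc:
  "i < n \<Longrightarrow> j < n \<Longrightarrow> (A ^\<^sub>m Suc k) $$ (i, j) = (\<Sum>l<n. (A ^\<^sub>m k) $$ (i, l) * e l j)"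
  using carrier pow_carrier_mat[OF carrier, of k]
  by (auto simp: scalar_prod_def atLeast0LessThan entry intro!: sum.cong)

private lemma comm: "(i, j) \<in> E \<longleftrightarrow> (j, i) \<in> E"
  using simple unfolding simple_rel_def by (meson symD)

private lemma moment: "spectral_moment k G = (\<Sum>i<n. (A ^\<^sub>m k) $$ (i, i))"
proof -
  have "transpose_mat A = A"
    using carrier by (intro eq_matI) (auto simp: entry comm)
  from power_sum_eigenvalues_eq_trace[OF carrier this, of k]
  show ?thesis using carrier pow_carrier_mat[OF carrier, of k]
    by (simp add: spectral_moment_def adjacency_eigenvalues_def mat_trace_def)
qed

lemma spectral_moment_0: "spectral_moment 0 G = real n"
  using carrier by (simp add: moment)

private lemma entry_1: "i < n \<Longrightarrow> j < n \<Longrightarrow> (A ^\<^sub>m Suc 0) $$ (i, j) = e i j"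
  using carrier by (simp add: entry)

private lemma entry_2:
  assumes "i < n" "j < n"
  shows "(A ^\<^sub>m Suc (Suc 0)) $$ (i, j) = (\<Sum>l<n. e i l * e l j)"
  unfolding entry_Suc[OF assms] by (intro sum.cong refl) (subst entry_1, use assms in auto)

private lemma entry_3:
  assumes "i < n" "j < n"
  shows "(A ^\<^sub>m Suc (Suc (Suc 0))) $$ (i, j) = (\<Sum>l<n. (\<Sum>k<n. e i k * e k l) * e l j)"
  unfolding entry_Suc[OF assms] by (intro sum.cong refl) (subst entry_2, use assms in auto)

private lemma entry_4:
  assumes "i < n" "j < n"
  shows "(A ^\<^sub>m Suc (Suc (Suc (Suc 0)))) $$ (i, j) =
    (\<Sum>m<n. (\<Sum>l<n. (\<Sum>k<n. e i k * e k l) * e l m) * e m j)"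
  unfolding entry_Suc[OF assms] by (intro sum.cong refl) (subst entry_3, use assms in auto)

lemma spectral_moment_1: "spectral_moment 1 G = 0"
  unfolding moment One_nat_def using simple
  by (auto simp: entry_1 simple_rel_def irrefl_def simp del: pow_mat.simps)

lemma spectral_moment_2: "spectral_moment 2 G = real (card E)"
proof -
  have "spectral_moment 2 G = (\<Sum>i<n. \<Sum>j<n. e i j * e j i)"
    unfolding moment numeral_2_eq_2 by (intro sum.cong refl entry_2) auto
  also have "\<dots> = (\<Sum>x\<in>{..<n} \<times> {..<n}. of_bool (x \<in> E))"
    unfolding sum.cartesian_product by (intro sum.cong refl) (auto simp: comm)
  also have "\<dots> = real (card E)"
    using simple by (intro of_nat_card_filter[symmetric]) (auto simp: simple_rel_def)
  finally show ?thesis .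
qed

lemma spectral_moment_3: "spectral_moment 3 G = real (card (closed_walks3 E))"
proof -
  have "spectral_moment 3 G = (\<Sum>a<n. \<Sum>c<n. (\<Sum>b<n. e a b * e b c) * e c a)"
    unfolding moment numeral_3_eq_3 by (intro sum.cong refl entry_3) auto
  also have "\<dots> = (\<Sum>a<n. \<Sum>c<n. \<Sum>b<n. e a b * e b c * e c a)"
    by (simp only: sum_distrib_right)
  also have "\<dots> = (\<Sum>x\<in>{..<n} \<times> {..<n} \<times> {..<n}.
      of_bool (case x of (a, c, b) \<Rightarrow> (a, b) \<in> E \<and> (b, c) \<in> E \<and> (c, a) \<in> E))"
    unfolding sum.cartesian_product by (intro sum.cong refl) auto
  \<comment> \<open>Matrix powers are expanded at the last step of a walk, so the sums bind
    \<open>c\<close> before \<open>b\<close>; the image only restores the order along the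
    walk.\<close>
  also have "\<dots> = real (card ((\<lambda>(a, b, c). (a, c, b)) ` closed_walks3 E))"
    using simple by (intro of_nat_card_filter[symmetric])
      (auto simp: simple_rel_def closed_walks3_def image_iff)
  also have "card ((\<lambda>(a, b, c). (a, c, b)) ` closed_walks3 E) = card (closed_walks3 E)"
    by (intro card_image) (auto simp: inj_on_def)
  finally show ?thesis .
qed

lemma spectral_moment_4: "spectral_moment 4 G = real (card (closed_walks4 E))"
proof -
  have four: "4 = Suc (Suc (Suc (Suc 0)))" by simp
  have "spectral_moment 4 G =
      (\<Sum>a<n. \<Sum>d<n. (\<Sum>c<n. (\<Sum>b<n. e a b * e b c) * e c d) * e d a)"
    unfolding moment four by (intro sum.cong refl entry_4) auto
  also have "\<dots> = (\<Sum>a<n. \<Sum>d<n. \<Sum>c<n. \<Sum>b<n. e a b * e b c * e c d * e d a)"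
    by (simp only: sum_distrib_right)
  also have "\<dots> = (\<Sum>x\<in>{..<n} \<times> {..<n} \<times> {..<n} \<times> {..<n}.
      of_bool (case x of (a, d, c, b) \<Rightarrow> (a, b) \<in> E \<and> (b, c) \<in> E \<and> (c, d) \<in> E \<and> (d, a) \<in> E))"
    unfolding sum.cartesian_product by (intro sum.cong refl) auto
  also have "\<dots> = real (card ((\<lambda>(a, b, c, d). (a, d, c, b)) ` closed_walks4 E))"
    using simple by (intro of_nat_card_filter[symmetric])
      (auto simp: simple_rel_def closed_walks4_def image_iff)
  also have "card ((\<lambda>(a, b, c, d). (a, d, c, b)) ` closed_walks4 E) = card (closed_walks4 E)"
    by (intro card_image) (auto simp: inj_on_def)
  finally show ?thesis .
qed

end

text \<open>A closed walk of length four that is no 4-cycle backtracks, with \<open>a = c\<close> or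
  \<open>b = d\<close>. Each kind amounts to a vertex with an ordered pair of neighbours, and both
  at once to an arc. Adding \<open>card E\<close> on the left avoids subtraction on
  naturals.\<close>

lemma card_closed_walks4:
  fixes E :: "'a rel"
  assumes fin: "finite V" and sub: "E \<subseteq> V \<times> V" and sym: "sym E"
  shows "card (closed_walks4 E) + card E = 2 * (\<Sum>v\<in>V. (deg E v)\<^sup>2) + card (four_cycles E)"
proof -
  have finE: "finite E" using finite_subset[OF sub] fin by simp
  have comm: "(a, b) \<in> E \<longleftrightarrow> (b, a) \<in> E" for a b using sym by (meson symD)
  define S where "S = (SIGMA v:V. E `` {v} \<times> E `` {v})"
  define X where "X = {(a, b, c, d) \<in> closed_walks4 E. a = c}"
  define Y where "Y = {(a, b, c, d) \<in> closed_walks4 E. b = d}"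
  have cardS: "card S = (\<Sum>v\<in>V. (deg E v)\<^sup>2)"
    unfolding S_def using finE fin
    by (subst card_SigmaI) (auto simp: card_cartesian_product power2_eq_square)
  have "X = (\<lambda>(a, b, d). (a, b, a, d)) ` S"
    using sub by (auto simp: X_def S_def closed_walks4_def image_iff comm)
  then have cX: "card X = card S" by (simp add: card_image inj_on_def split_beta prod_eq_iff)
  have "Y = (\<lambda>(b, a, c). (a, b, c, b)) ` S"
    using sub by (auto simp: Y_def S_def closed_walks4_def image_iff comm)
  then have cY: "card Y = card S" by (simp add: card_image inj_on_def split_beta prod_eq_iff)
  have "X \<inter> Y = (\<lambda>(a, b). (a, b, a, b)) ` E"
    by (auto simp: X_def Y_def closed_walks4_def image_iff comm)
  then have cXY: "card (X \<inter> Y) = card E" by (simp add: card_image inj_on_def split_beta prod_eq_iff)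
  have fin4: "finite (closed_walks4 E)"
    by (rule finite_subset[of _ "V \<times> V \<times> V \<times> V"]) (use sub fin in \<open>auto simp: closed_walks4_def\<close>)
  have split: "closed_walks4 E = (X \<union> Y) \<union> four_cycles E" "(X \<union> Y) \<inter> four_cycles E = {}"
    by (auto simp: X_def Y_def four_cycles_def)
  have finXY: "finite X" "finite Y" "finite (four_cycles E)"
    using fin4 split(1) by (metis finite_Un)+
  have "card (closed_walks4 E) = card (X \<union> Y) + card (four_cycles E)"
    using split finXY by (simp add: card_Un_disjoint)
  moreover have "card (X \<union> Y) + card (X \<inter> Y) = card X + card Y"
    by (rule card_Un_Int[symmetric]) (fact finXY)+
  ultimately show ?thesis using cX cY cXY cardS by simp
qed

section \<open>Trees hanging off a clique\<close>

definition triples_distinct :: "'a set \<Rightarrow> ('a \<times> 'a \<times> 'a) set" where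
  "triples_distinct Q = (SIGMA a:Q. SIGMA b:Q - {a}. Q - {a, b})"

definition quadruples_distinct :: "'a set \<Rightarrow> ('a \<times> 'a \<times> 'a \<times> 'a) set" where
  "quadruples_distinct Q = (SIGMA a:Q. SIGMA b:Q - {a}. SIGMA c:Q - {a, b}. Q - {a, b, c})"

lemma card_triples_distinct:
  assumes "finite Q"
  shows "card (triples_distinct Q) = card Q * ((card Q - 1) * (card Q - 2))"
proof -
  have "card (Q - {a, b}) = card Q - 2" if "a \<in> Q" "b \<in> Q - {a}" for a b
    using that assms by (subst card_Diff_subset) auto
  then show ?thesis using assms by (simp add: triples_distinct_def cong: sum.cong_simp)
qed

lemma card_quadruples_distinct:
  assumes "finite Q"
  shows "card (quadruples_distinct Q) = card Q * ((card Q - 1) * ((card Q - 2) * (card Q - 3)))"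
proof -
  have "card (Q - {a, b}) = card Q - 2" if "a \<in> Q" "b \<in> Q - {a}" for a b
    using that assms by (subst card_Diff_subset) auto
  moreover have "card (Q - {a, b, c}) = card Q - 3"
    if "a \<in> Q" "b \<in> Q - {a}" "c \<in> Q - {a, b}" for a b c
    using that assms by (subst card_Diff_subset) auto
  ultimately show ?thesis using assms by (simp add: quadruples_distinct_def cong: sum.cong_simp)
qed

definition rooted_arcs :: "'a set \<Rightarrow> 'a set \<Rightarrow> ('a \<Rightarrow> 'a) \<Rightarrow> 'a rel" where
  "rooted_arcs V Q p = {(a, b). a \<in> Q \<and> b \<in> Q \<and> a \<noteq> b} \<union>
     (\<lambda>v. (v, p v)) ` (V - Q) \<union> (\<lambda>v. (p v, v)) ` (V - Q)"

text \<open>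
  Trees hanging off a clique \<open>Q\<close>: every vertex outside \<open>Q\<close> has a parent \<open>p v\<close>, and the rank
  \<open>r\<close> forces the iterated parents to end up in \<open>Q\<close>.
\<close>

locale rooted_clique =
  fixes V Q :: "'a set" and p :: "'a \<Rightarrow> 'a" and r :: "'a \<Rightarrow> nat"
  assumes finite_V: "finite V" and Q_subset: "Q \<subseteq> V" and Q_nonempty: "Q \<noteq> {}"
    and parent_in: "v \<in> V - Q \<Longrightarrow> p v \<in> V"
    and rank_parent: "v \<in> V - Q \<Longrightarrow> r (p v) < r v"
begin

abbreviation "E \<equiv> rooted_arcs V Q p"

definition children :: "'a \<Rightarrow> nat" where
  "children v = card {x \<in> V - Q. p x = v}"

lemma finite_Q: "finite Q"
  using finite_V Q_subset finite_subset by blast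

lemma arcs_subset: "E \<subseteq> V \<times> V"
  using Q_subset parent_in by (auto simp: rooted_arcs_def)

lemma arcs_comm: "(a, b) \<in> E \<longleftrightarrow> (b, a) \<in> E"
  by (auto simp: rooted_arcs_def)

lemma sym_arcs: "sym E"
  using arcs_comm by (auto intro!: symI)

lemma parent_neq: "v \<in> V - Q \<Longrightarrow> p v \<noteq> v"
  using rank_parent[of v] by auto

lemma irrefl_arcs: "irrefl E"
  using parent_neq by (force simp: rooted_arcs_def irrefl_def)

lemma arc_outside_cases:
  assumes "(x, y) \<in> E" "x \<notin> Q" "y \<noteq> p x"
  shows "y \<in> V - Q" "r x < r y"
  using assms rank_parent by (auto simp: rooted_arcs_def)

lemma reach_Q: "v \<in> V \<Longrightarrow> \<exists>q\<in>Q. (v, q) \<in> E\<^sup>*"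
proof (induction "r v" arbitrary: v rule: less_induct)
  case less
  show ?case
  proof (cases "v \<in> Q")
    case False
    then have "(v, p v) \<in> E" using less.prems by (auto simp: rooted_arcs_def)
    moreover obtain q where "q \<in> Q" "(p v, q) \<in> E\<^sup>*"
      using less False parent_in rank_parent by blast
    ultimately show ?thesis by (meson converse_rtrancl_into_rtrancl)
  qed auto
qed

lemma connected_arcs:
  assumes "u \<in> V" "v \<in> V"
  shows "(u, v) \<in> E\<^sup>*"
proof -
  obtain a b where ab: "a \<in> Q" "b \<in> Q" "(u, a) \<in> E\<^sup>*" "(v, b) \<in> E\<^sup>*"
    using reach_Q assms by blast
  have "(a, b) \<in> E\<^sup>*" using ab by (cases "a = b") (auto simp: rooted_arcs_def)
  moreover have "(b, v) \<in> E\<^sup>*" using ab(4) sym_arcs by (meson symD sym_rtrancl)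
  ultimately show ?thesis using ab(3) by (meson rtrancl_trans)
qed

text \<open>The set \<open>D\<close> of descendants of \<open>v\<close> is closed under all arcs
  except the removed pair, and every rank in it is at least \<open>r v\<close>, so it misses
  \<open>p v\<close>.\<close>

lemma parent_arc_bridge:
  assumes v: "v \<in> V - Q"
  shows "(v, p v) \<notin> (E - {(v, p v), (p v, v)})\<^sup>*"
proof
  define up where "up = {(x, p x) | x. x \<in> V - Q}"
  define D where "D = {x. (x, v) \<in> up\<^sup>*}"
  have rank: "r b \<le> r a" if "(a, b) \<in> up\<^sup>*" for a b
    using that
  proof (induction rule: rtrancl_induct)
    case (step y z)
    then show ?case using rank_parent[of y] by (auto simp: up_def)
  qed simp
  have closed: "y \<in> D" if "(x, y) \<in> E - {(v, p v), (p v, v)}" "x \<in> D" for x y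
  proof -
    from that(1) consider "x \<in> Q" "y \<in> Q" | "x \<in> V - Q" "y = p x" | "y \<in> V - Q" "x = p y"
      by (auto simp: rooted_arcs_def)
    then show ?thesis
    proof cases
      case 1
      with that(2) v show ?thesis
        by (auto simp: D_def up_def elim: converse_rtranclE)
    next
      case 2
      with that have "x \<noteq> v" by auto
      with that(2) obtain z where "(x, z) \<in> up" "(z, v) \<in> up\<^sup>*"
        by (auto simp: D_def elim: converse_rtranclE)
      then show ?thesis using 2 by (auto simp: up_def D_def)
    next
      case 3
      then have "(y, x) \<in> up" by (auto simp: up_def)
      with that(2) show ?thesis by (auto simp: D_def intro: converse_rtrancl_into_rtrancl)
    qed
  qed
  assume "(v, p v) \<in> (E - {(v, p v), (p v, v)})\<^sup>*"
  then have "p v \<in> D"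
  proof (induction rule: rtrancl_induct)
    case base
    then show ?case by (simp add: D_def)
  next
    case (step y z)
    then show ?case using closed by blast
  qed
  then have "r v \<le> r (p v)" using rank by (auto simp: D_def)
  with rank_parent[OF v] show False by simp
qed

lemma clique_arc_not_bridge:
  assumes "a \<in> Q" "b \<in> Q" "a \<noteq> b" "3 \<le> card Q"
  shows "(a, b) \<in> (E - {(a, b), (b, a)})\<^sup>*"
proof -
  have "card (Q - {a, b}) > 0" using assms finite_Q by (simp add: card_Diff_insert)
  then obtain c where "c \<in> Q - {a, b}" by (auto simp: card_gt_0_iff)
  then have "(a, c) \<in> E - {(a, b), (b, a)}" "(c, b) \<in> E - {(a, b), (b, a)}"
    using assms by (auto simp: rooted_arcs_def)
  then show ?thesis by (meson r_into_rtrancl rtrancl_trans)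
qed

text \<open>A vertex of maximal rank on a cycle leaving \<open>Q\<close> would need two distinct parents.\<close>

lemma cycle_in_clique:
  assumes fin: "finite C"
    and cyc: "\<And>x. x \<in> C \<Longrightarrow> \<exists>y\<in>C. \<exists>z\<in>C. y \<noteq> z \<and> (x, y) \<in> E \<and> (x, z) \<in> E"
  shows "C \<subseteq> Q"
proof (rule ccontr)
  assume "\<not> C \<subseteq> Q"
  then obtain x where x: "x \<in> C - Q" "\<And>y. y \<in> C - Q \<Longrightarrow> r y \<le> r x"
    using Max_in[of "r ` (C - Q)"] Max_ge[of "r ` (C - Q)"] fin
    by (smt (verit) Diff_eq_empty_iff finite_Diff finite_imageI image_iff image_is_empty)
  obtain y z where "y \<in> C" "z \<in> C" "y \<noteq> z" "(x, y) \<in> E" "(x, z) \<in> E" using cyc x(1) by blast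
  then obtain w where "w \<in> C" "(x, w) \<in> E" "w \<noteq> p x" by metis
  with arc_outside_cases[of x w] x show False by fastforce
qed

lemma closed_walks3_eq: "closed_walks3 E = triples_distinct Q"
proof
  show "closed_walks3 E \<subseteq> triples_distinct Q"
  proof clarify
    fix a b c assume "(a, b, c) \<in> closed_walks3 E"
    then have abc: "(a, b) \<in> E" "(b, c) \<in> E" "(c, a) \<in> E" by (auto simp: closed_walks3_def)
    then have neq: "a \<noteq> b" "b \<noteq> c" "c \<noteq> a" using irrefl_arcs by (auto simp: irrefl_def)
    have rev: "(b, a) \<in> E" "(c, b) \<in> E" "(a, c) \<in> E" using abc arcs_comm by blast+
    have "{a, b, c} \<subseteq> Q"
    proof (rule cycle_in_clique)
      fix x assume "x \<in> {a, b, c}"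
      then show "\<exists>y\<in>{a, b, c}. \<exists>z\<in>{a, b, c}. y \<noteq> z \<and> (x, y) \<in> E \<and> (x, z) \<in> E"
        using abc rev neq by blast
    qed simp
    then show "(a, b, c) \<in> triples_distinct Q" using neq by (auto simp: triples_distinct_def)
  qed
qed (auto simp: closed_walks3_def triples_distinct_def rooted_arcs_def)

lemma four_cycles_eq: "four_cycles E = quadruples_distinct Q"
proof
  show "four_cycles E \<subseteq> quadruples_distinct Q"
  proof clarify
    fix a b c d assume "(a, b, c, d) \<in> four_cycles E"
    then have abcd: "(a, b) \<in> E" "(b, c) \<in> E" "(c, d) \<in> E" "(d, a) \<in> E" and neq: "a \<noteq> c" "b \<noteq> d"
      by (auto simp: four_cycles_def closed_walks4_def)
    then have neq': "a \<noteq> b" "b \<noteq> c" "c \<noteq> d" "d \<noteq> a" using irrefl_arcs by (auto simp: irrefl_def)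
    have rev: "(b, a) \<in> E" "(c, b) \<in> E" "(d, c) \<in> E" "(a, d) \<in> E"
      using abcd arcs_comm by blast+
    have "{a, b, c, d} \<subseteq> Q"
    proof (rule cycle_in_clique)
      fix x assume "x \<in> {a, b, c, d}"
      then show "\<exists>y\<in>{a, b, c, d}. \<exists>z\<in>{a, b, c, d}. y \<noteq> z \<and> (x, y) \<in> E \<and> (x, z) \<in> E"
        using abcd rev neq by blast
    qed simp
    then show "(a, b, c, d) \<in> quadruples_distinct Q"
      using neq neq' by (auto simp: quadruples_distinct_def)
  qed
qed (auto simp: four_cycles_def closed_walks4_def quadruples_distinct_def rooted_arcs_def)

lemma card_arcs: "card E = card Q * (card Q - 1) + 2 * card (V - Q)"
proof -
  let ?K = "SIGMA a:Q. Q - {a}" and ?U = "(\<lambda>v. (v, p v)) ` (V - Q)" and ?D = "(\<lambda>v. (p v, v)) ` (V - Q)"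
  have E: "E = ?K \<union> (?U \<union> ?D)" by (auto simp: rooted_arcs_def)
  have "?U \<inter> ?D = {}"
  proof (rule ccontr)
    assume "?U \<inter> ?D \<noteq> {}"
    then obtain v w where "v \<in> V - Q" "w \<in> V - Q" "v = p w" "p v = w" by auto
    then show False using rank_parent[of v] rank_parent[of w] by simp
  qed
  moreover have "?K \<inter> (?U \<union> ?D) = {}" by auto
  moreover have "card ?U = card (V - Q)" "card ?D = card (V - Q)"
    by (auto intro!: card_image simp: inj_on_def)
  ultimately show ?thesis
    unfolding E using finite_V finite_Q by (simp add: card_Un_disjoint)
qed

lemma deg_clique:
  assumes "v \<in> Q"
  shows "deg E v = (card Q - 1) + children v"
proof -
  have "E `` {v} = (Q - {v}) \<union> {x \<in> V - Q. p x = v}"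
    using assms by (auto simp: rooted_arcs_def)
  moreover have "(Q - {v}) \<inter> {x \<in> V - Q. p x = v} = {}" by auto
  ultimately show ?thesis
    using assms finite_V finite_Q by (simp add: card_Un_disjoint children_def)
qed

lemma deg_outside:
  assumes "v \<in> V - Q"
  shows "deg E v = 1 + children v"
proof -
  have "E `` {v} = insert (p v) {x \<in> V - Q. p x = v}"
    using assms by (auto simp: rooted_arcs_def)
  moreover have "p v \<notin> {x \<in> V - Q. p x = v}"
    using rank_parent[of v] rank_parent[of "p v"] assms by force
  ultimately show ?thesis using finite_V by (simp add: children_def)
qed

lemma sum_children: "(\<Sum>v\<in>V. children v) = card (V - Q)"
proof -
  have "(\<Sum>v\<in>V. \<Sum>x\<in>{x \<in> V - Q. p x = v}. 1) = (\<Sum>x\<in>V - Q. 1 :: nat)"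
    using finite_V parent_in by (intro sum.group) auto
  then show ?thesis by (simp add: children_def)
qed

text \<open>The part of the sum of squared degrees that depends on the shape: what remains of the
  squares of \<open>card Q - 1 + children v\<close> in \<open>Q\<close> and
  \<open>1 + children v\<close> outside once the constant terms are split off.\<close>

definition weight :: nat where
  "weight = 2 * (card Q - 1) * (\<Sum>v\<in>Q. children v) + 2 * (\<Sum>v\<in>V - Q. children v) +
     (\<Sum>v\<in>V. (children v)\<^sup>2)"

lemma sum_split: "(\<Sum>v\<in>V. f v) = (\<Sum>v\<in>Q. f v) + (\<Sum>v\<in>V - Q. f v)" for f :: "'a \<Rightarrow> nat"
  using finite_V Q_subset by (metis sum.subset_diff add.commute)

lemma sum_deg_squares:
  "(\<Sum>v\<in>V. (deg E v)\<^sup>2) = card Q * (card Q - 1)\<^sup>2 + card (V - Q) + weight"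
proof -
  have "(\<Sum>v\<in>V. (deg E v)\<^sup>2) =
      (\<Sum>v\<in>Q. ((card Q - 1) + children v)\<^sup>2) + (\<Sum>v\<in>V - Q. (1 + children v)\<^sup>2)"
    unfolding sum_split by (simp add: deg_clique deg_outside)
  also have "(\<Sum>v\<in>Q. ((card Q - 1) + children v)\<^sup>2) =
      card Q * (card Q - 1)\<^sup>2 + 2 * (card Q - 1) * (\<Sum>v\<in>Q. children v) + (\<Sum>v\<in>Q. (children v)\<^sup>2)"
    by (simp add: power2_sum sum.distrib sum_distrib_left mult.assoc)
  also have "(\<Sum>v\<in>V - Q. (1 + children v)\<^sup>2) =
      card (V - Q) + 2 * (\<Sum>v\<in>V - Q. children v) + (\<Sum>v\<in>V - Q. (children v)\<^sup>2)"
    by (simp only: power2_sum sum.distrib) (simp add: sum_distrib_left)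
  finally show ?thesis by (simp add: weight_def sum_split[of "\<lambda>v. (children v)\<^sup>2"])
qed

text \<open>Once the sizes of \<open>Q\<close> and \<open>V - Q\<close> are fixed,
  \<open>weight\<close> is the only varying term, so comparing S_4 means comparing weights.\<close>

lemma card_closed_walks4_eq:
  "card (closed_walks4 E) + (card Q * (card Q - 1) + 2 * card (V - Q)) =
    2 * (card Q * (card Q - 1)\<^sup>2 + card (V - Q) + weight) +
    card Q * ((card Q - 1) * ((card Q - 2) * (card Q - 3)))"
  using card_closed_walks4[OF finite_V arcs_subset sym_arcs]
  by (simp only: card_arcs sum_deg_squares four_cycles_eq card_quadruples_distinct[OF finite_Q])

end

section \<open>Bridges and components\<close>

definition component :: "'a set \<Rightarrow> 'a rel \<Rightarrow> 'a \<Rightarrow> 'a set" where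
  "component V E u = {v \<in> V. (u, v) \<in> E\<^sup>*}"

definition components :: "'a set \<Rightarrow> 'a rel \<Rightarrow> 'a set set" where
  "components V E = component V E ` V"

definition connected_rel :: "'a set \<Rightarrow> 'a rel \<Rightarrow> bool" where
  "connected_rel V E \<longleftrightarrow> V \<noteq> {} \<and> (\<forall>u\<in>V. \<forall>v\<in>V. (u, v) \<in> E\<^sup>*)"

definition bridges :: "'a rel \<Rightarrow> 'a rel" where
  "bridges E = {(u, v) \<in> E. (u, v) \<notin> (E - {(u, v), (v, u)})\<^sup>*}"

lemma sym_rtrancl_swap: "sym E \<Longrightarrow> (u, v) \<in> E\<^sup>* \<longleftrightarrow> (v, u) \<in> E\<^sup>*"
  by (meson symD sym_rtrancl)

lemma component_eq_iff:
  assumes "sym E" "u \<in> V" "v \<in> V"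
  shows "component V E u = component V E v \<longleftrightarrow> (u, v) \<in> E\<^sup>*"
  using assms sym_rtrancl_swap[OF assms(1)] unfolding component_def
  by (auto intro: rtrancl_trans)

lemma components_empty: "components V {} = (\<lambda>u. {u}) ` V"
  by (auto simp: components_def component_def)

lemma card_components_connected: "connected_rel V E \<Longrightarrow> card (components V E) = 1"
proof -
  assume *: "connected_rel V E"
  then have "components V E = {V}" by (auto simp: connected_rel_def components_def component_def)
  then show ?thesis by simp
qed

text \<open>A path using the edge reaches an endpoint before its first use and leaves from an
  endpoint after its last use, both times without the edge.\<close>

lemma rtrancl_remove_edge:
  assumes sym: "sym E" and ab: "(a, b) \<in> E\<^sup>*"
  shows "(a, b) \<in> (E - {(u, v), (v, u)})\<^sup>* \<or>
    ((a, u) \<in> (E - {(u, v), (v, u)})\<^sup>* \<or> (a, v) \<in> (E - {(u, v), (v, u)})\<^sup>*) \<and>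
    ((u, b) \<in> (E - {(u, v), (v, u)})\<^sup>* \<or> (v, b) \<in> (E - {(u, v), (v, u)})\<^sup>*)"
    (is "?P b")
  using ab
proof (induction rule: rtrancl_induct)
  case (step y z)
  show ?case
  proof (cases "(y, z) \<in> {(u, v), (v, u)}")
    case True
    then show ?thesis using step.IH by auto
  next
    case False
    then have "(y, z) \<in> E - {(u, v), (v, u)}" using step.hyps by blast
    then show ?thesis using step.IH by (meson rtrancl.rtrancl_into_rtrancl)
  qed
qed simp

lemma components_remove_nonbridge:
  assumes sym: "sym E" and uv: "(u, v) \<in> (E - {(u, v), (v, u)})\<^sup>*"
  shows "components V (E - {(u, v), (v, u)}) = components V E"
proof -
  let ?E = "E - {(u, v), (v, u)}"
  have sE: "sym ?E" using sym by (auto simp: sym_def)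
  have vu: "(v, u) \<in> ?E\<^sup>*" using uv sym_rtrancl_swap[OF sE] by blast
  have "(a, b) \<in> ?E\<^sup>*" if "(a, b) \<in> E\<^sup>*" for a b
    using rtrancl_remove_edge[OF sym that, of u v] uv vu by (meson rtrancl_trans)
  moreover have "?E\<^sup>* \<subseteq> E\<^sup>*" by (rule rtrancl_mono) auto
  ultimately have "?E\<^sup>* = E\<^sup>*" by auto
  then show ?thesis by (simp add: components_def component_def)
qed

text \<open>Only the component \<open>W\<close> around the edge changes: it splits into the parts
  around \<open>u\<close> and \<open>v\<close>, while the components in \<open>R\<close> survive
  unchanged.\<close>

lemma card_components_remove_bridge:
  assumes fin: "finite V" and sub: "E \<subseteq> V \<times> V" and sym: "sym E" and uv: "(u, v) \<in> E"
    and bridge: "(u, v) \<notin> (E - {(u, v), (v, u)})\<^sup>*"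
  shows "card (components V (E - {(u, v), (v, u)})) = card (components V E) + 1"
proof -
  let ?E = "E - {(u, v), (v, u)}"
  let ?c = "component V E" and ?c' = "component V ?E"
  have sE: "sym ?E" using sym by (auto simp: sym_def)
  have V: "u \<in> V" "v \<in> V" using uv sub by auto
  have mono: "?E\<^sup>* \<subseteq> E\<^sup>*" by (rule rtrancl_mono) auto
  define W where "W = ?c' u \<union> ?c' v"
  define R where "R = ?c' ` (V - W)"
  have inW: "w \<in> W \<longleftrightarrow> w \<in> V \<and> ((w, u) \<in> ?E\<^sup>* \<or> (w, v) \<in> ?E\<^sup>*)" for w
    using sym_rtrancl_swap[OF sE] by (auto simp: W_def component_def)
  have cW: "?c w = W" if "w \<in> W" for w
  proof -
    have "(w, x) \<in> E\<^sup>* \<longleftrightarrow> x \<in> W" if "x \<in> V" for x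
    proof
      assume "(w, x) \<in> E\<^sup>*"
      from rtrancl_remove_edge[OF sym this, of u v] show "x \<in> W"
        using \<open>w \<in> W\<close> \<open>x \<in> V\<close> inW sym_rtrancl_swap[OF sE] by (meson rtrancl_trans)
    next
      assume "x \<in> W"
      have vu: "(u, v) \<in> E\<^sup>*" "(v, u) \<in> E\<^sup>*" using uv sym by (auto dest: symD)
      have "(w, u) \<in> E\<^sup>*" using \<open>w \<in> W\<close> inW mono vu by (meson rtrancl_trans subsetD)
      moreover have "(x, u) \<in> E\<^sup>*" using \<open>x \<in> W\<close> inW mono vu by (meson rtrancl_trans subsetD)
      ultimately show "(w, x) \<in> E\<^sup>*" using sym_rtrancl_swap[OF sym] by (meson rtrancl_trans)
    qed
    then show ?thesis using inW by (auto simp: component_def)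
  qed
  have cR: "?c w = ?c' w" if "w \<in> V - W" for w
  proof -
    have "(w, x) \<in> E\<^sup>* \<longleftrightarrow> (w, x) \<in> ?E\<^sup>*" for x
      using rtrancl_remove_edge[OF sym, of w x u v] mono that inW by blast
    then show ?thesis by (simp add: component_def)
  qed
  have WV: "W \<subseteq> V" "u \<in> W" "v \<in> W" using V by (auto simp: inW)
  have "components V E = ?c ` W \<union> ?c ` (V - W)" using WV by (auto simp: components_def)
  also have "?c ` W = {W}" using cW WV by auto
  also have "?c ` (V - W) = R" unfolding R_def using cR by (intro image_cong) auto
  finally have 1: "components V E = insert W R" by simp
  have cW': "?c' w \<in> {?c' u, ?c' v}" if "w \<in> W" for w
    using that inW component_eq_iff[OF sE] V by blast
  have "components V ?E = ?c' ` W \<union> ?c' ` (V - W)" using WV by (auto simp: components_def)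
  also have "?c' ` W = {?c' u, ?c' v}" using cW' WV by auto
  finally have 2: "components V ?E = insert (?c' u) (insert (?c' v) R)" by (simp add: R_def)
  have notin: "X \<notin> R" if "u \<in> X \<or> v \<in> X" for X
  proof
    assume "X \<in> R"
    then obtain w where "w \<in> V - W" "X = ?c' w" by (auto simp: R_def)
    then show False using that inW by (auto simp: component_def)
  qed
  have self: "u \<in> ?c' u" "v \<in> ?c' v" using V by (auto simp: component_def)
  have neq: "?c' u \<noteq> ?c' v" using component_eq_iff[OF sE V] bridge by simp
  have "finite R" using fin by (simp add: R_def)
  then show ?thesis unfolding 1 2 using notin self neq WV by simp
qed

text \<open>The bridges go one opposite pair at a time, and a bridge of \<open>E\<close> stays one
  in any subgraph containing it. \<open>E0\<close> is kept apart from \<open>E\<close> because the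
  count is also needed after deleting a non-bridge. The factors 2 reflect two arcs per edge.\<close>

lemma card_components_remove_bridges:
  assumes simple: "simple_rel V E"
    and E0: "E0 \<subseteq> E" "sym E0" and B: "B \<subseteq> bridges E" "sym B" "B \<subseteq> E0"
  shows "2 * card (components V (E0 - B)) = 2 * card (components V E0) + card B"
proof -
  have finE: "finite E" using simple by (auto simp: simple_rel_def intro: finite_subset)
  have "finite B" using finE B(3) E0(1) by (meson finite_subset)
  then show ?thesis using B
  proof (induction "card B" arbitrary: B rule: less_induct)
    case less
    show ?case
    proof (cases "B = {}")
      case False
      then obtain u v where uv: "(u, v) \<in> B" by auto
      then have vu: "(v, u) \<in> B" using less.prems by (auto dest: symD)
      have neq: "(u, v) \<noteq> (v, u)" using uv less.prems(2) simple
        by (auto simp: bridges_def simple_rel_def irrefl_def)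
      define B' where "B' = B - {(u, v), (v, u)}"
      have "card B = card B' + 2"
        using less.prems(1) uv vu neq card_Diff_subset[of "{(u, v), (v, u)}" B]
          card_mono[of B "{(u, v), (v, u)}"] by (simp add: B'_def)
      moreover have "2 * card (components V (E0 - B')) = 2 * card (components V E0) + card B'"
      proof (rule less.hyps)
        show "sym B'" using less.prems(3) by (auto simp: B'_def sym_def)
      qed (use less.prems \<open>card B = card B' + 2\<close> in \<open>auto simp: B'_def\<close>)
      moreover have "E0 - B = (E0 - B') - {(u, v), (v, u)}" using uv vu by (auto simp: B'_def)
      moreover have "card (components V ((E0 - B') - {(u, v), (v, u)})) = card (components V (E0 - B')) + 1"
      proof (rule card_components_remove_bridge)
        show "finite V" "E0 - B' \<subseteq> V \<times> V" using simple E0 by (auto simp: simple_rel_def)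
        show "sym (E0 - B')" using E0(2) less.prems(3) by (auto simp: B'_def sym_def)
        show "(u, v) \<in> E0 - B'" using uv less.prems by (auto simp: B'_def)
        have "(E0 - B' - {(u, v), (v, u)})\<^sup>* \<subseteq> (E - {(u, v), (v, u)})\<^sup>*"
          by (rule rtrancl_mono) (use E0 in auto)
        then show "(u, v) \<notin> (E0 - B' - {(u, v), (v, u)})\<^sup>*"
          using uv less.prems(2) by (auto simp: bridges_def)
      qed
      ultimately show ?thesis by simp
    qed simp
  qed
qed

lemma sym_bridges: "sym E \<Longrightarrow> sym (bridges E)"
proof (rule symI)
  fix u v assume s: "sym E" and "(u, v) \<in> bridges E"
  then have "(u, v) \<in> E" "(u, v) \<notin> (E - {(u, v), (v, u)})\<^sup>*" by (auto simp: bridges_def)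
  moreover have "sym (E - {(u, v), (v, u)})" using s by (auto simp: sym_def)
  ultimately show "(v, u) \<in> bridges E"
    using s sym_rtrancl_swap by (fastforce simp: bridges_def insert_commute dest: symD)
qed

lemma card_sym_rel:
  assumes fin: "finite B" and sym: "sym B" and irr: "irrefl B"
  shows "card B = 2 * card {{u, v} | u v. (u, v) \<in> B}"
proof -
  let ?f = "\<lambda>(u, v). {u, v}"
  have S: "{{u, v} | u v. (u, v) \<in> B} = ?f ` B" by auto
  have two: "card {x \<in> B. ?f x = s} = 2" if s: "s \<in> ?f ` B" for s
  proof -
    obtain u v where uv: "(u, v) \<in> B" "s = {u, v}" using s by auto
    then have "{x \<in> B. ?f x = s} = {(u, v), (v, u)}" "u \<noteq> v"
      using sym irr by (auto simp: doubleton_eq_iff irrefl_def dest: symD)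
    then show ?thesis by simp
  qed
  have "card B = (\<Sum>s\<in>?f ` B. \<Sum>x\<in>{x \<in> B. ?f x = s}. 1)"
    using fin by (subst sum.group) auto
  also have "\<dots> = (\<Sum>s\<in>?f ` B. 2)"
    by (intro sum.cong refl) (simp only: card_eq_sum[symmetric] two)
  finally show ?thesis unfolding S by simp
qed

section \<open>Connectivity and cut edges read off the arc relation\<close>

lemma pair_graph_iff: "pair_graph G \<longleftrightarrow> simple_rel (pverts G) (parcs G)"
proof
  assume "pair_graph G"
  then interpret pair_graph G .
  show "simple_rel (pverts G) (parcs G)"
    using pair_finite_verts in_arcsD1 in_arcsD2 pair_sym_arcs no_loops'
    unfolding simple_rel_def irrefl_def symmetric_def by (simp add: subset_iff) blast
next
  assume *: "simple_rel (pverts G) (parcs G)"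
  then have "finite (parcs G)" by (auto simp: simple_rel_def intro: finite_subset)
  with * show "pair_graph G"
    by unfold_locales (auto simp: simple_rel_def irrefl_def symmetric_def)
qed

context
  fixes G :: "'a pair_pre_digraph"
  assumes G: "pair_graph G"
begin

interpretation pair_graph G by (rule G)

lemma reachable_iff_rtrancl:
  "reachable (with_proj G) u v \<longleftrightarrow> u \<in> pverts G \<and> v \<in> pverts G \<and> (u, v) \<in> (parcs G)\<^sup>*"
proof safe
  assume *: "reachable (with_proj G) u v"
  show "u \<in> pverts G" "v \<in> pverts G" using reachable_in_verts[OF *] by auto
  show "(u, v) \<in> (parcs G)\<^sup>*" using reachable_rtranclI[OF *] by simp
next
  assume "(u, v) \<in> (parcs G)\<^sup>*" and u: "u \<in> pverts G"
  then show "reachable (with_proj G) u v"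
  proof (induction rule: rtrancl_induct)
    case (step y z)
    then show ?case using reachable_adj_trans by simp
  qed (use u in simp)
qed

lemma connected_iff_connected_rel:
  "Digraph_Component.connected (with_proj G) \<longleftrightarrow> connected_rel (pverts G) (parcs G)"
proof -
  have "parcs (mk_symmetric (with_proj G)) = parcs G"
    using pair_sym_arcs by (auto simp: parcs_mk_symmetric symmetric_def dest: symD)
  then have "mk_symmetric (with_proj G) = G" by simp
  then show ?thesis
    by (auto simp: Digraph_Component.connected_def strongly_connected_def connected_rel_def
        reachable_iff_rtrancl)
qed

lemma card_sccs_eq: "card (pre_digraph.sccs (with_proj G)) = card (components (pverts G) (parcs G))"
proof -
  have "scc_of u = component (pverts G) (parcs G) u" if "u \<in> pverts G" for u
    using that sym_rtrancl_swap[of "parcs G" u] pair_sym_arcs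
    by (auto simp: scc_of_def component_def reachable_iff_rtrancl symmetric_def)
  then have "sccs_verts = components (pverts G) (parcs G)"
    by (auto simp: sccs_verts_conv_scc_of components_def)
  then show ?thesis using card_sccs_verts by simp
qed

end

text \<open>A connected graph has one component, and deleting an edge either keeps this number or
  raises it by exactly one, so having two components afterwards is the bridge condition.\<close>

lemma cut_edges_eq_bridges:
  assumes G: "pair_graph G" and con: "connected_rel (pverts G) (parcs G)"
  shows "cut_edges G = {{u, v} | u v. (u, v) \<in> bridges (parcs G)}"
proof -
  have simple: "simple_rel (pverts G) (parcs G)" using G pair_graph_iff by blast
  have "card (pre_digraph.sccs (with_proj (del_edge u v G))) = 2 \<longleftrightarrow> (u, v) \<in> bridges (parcs G)"
    if uv: "(u, v) \<in> parcs G" for u v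
  proof -
    have "pair_graph (del_edge u v G)"
      using simple unfolding pair_graph_iff by (auto simp: del_edge_def simple_rel_def sym_def irrefl_def)
    from card_sccs_eq[OF this] have
      "card (pre_digraph.sccs (with_proj (del_edge u v G))) =
        card (components (pverts G) (parcs G - {(u, v), (v, u)}))" by (simp add: del_edge_def)
    then show ?thesis
      using card_components_connected[OF con] uv simple
        components_remove_nonbridge[of "parcs G" u v "pverts G"]
        card_components_remove_bridge[of "pverts G" "parcs G" u v]
      by (cases "(u, v) \<in> bridges (parcs G)") (auto simp: bridges_def simple_rel_def)
  qed
  then show ?thesis unfolding cut_edges_def by (auto simp: bridges_def)
qed

lemma mem_graphs_with_cut_edges_iff:
  "G \<in> graphs_with_cut_edges n k \<longleftrightarrow> pverts G = {..<n} \<and> simple_rel {..<n} (parcs G) \<and>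
     connected_rel {..<n} (parcs G) \<and> card (bridges (parcs G)) = 2 * k"
proof -
  have *: "card (bridges (parcs G)) = 2 * card (cut_edges G)"
    if "simple_rel (pverts G) (parcs G)" "connected_rel (pverts G) (parcs G)"
  proof -
    have B: "bridges (parcs G) \<subseteq> parcs G" by (auto simp: bridges_def)
    have "finite (parcs G)" using that(1) by (auto simp: simple_rel_def intro: finite_subset)
    then have "finite (bridges (parcs G))" using B by (rule rev_finite_subset)
    moreover have "irrefl (bridges (parcs G))"
      using that(1) B unfolding simple_rel_def irrefl_def by blast
    moreover have "sym (bridges (parcs G))"
      using that(1) sym_bridges unfolding simple_rel_def by blast
    ultimately have "card (bridges (parcs G)) = 2 * card {{u, v} | u v. (u, v) \<in> bridges (parcs G)}"
      by (intro card_sym_rel)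
    then show ?thesis using cut_edges_eq_bridges[of G] that pair_graph_iff[of G] by simp
  qed
  then have **: "card (cut_edges G) = k \<longleftrightarrow> card (bridges (parcs G)) = 2 * k"
    if "simple_rel (pverts G) (parcs G)" "connected_rel (pverts G) (parcs G)"
    using that by simp
  have mem: "G \<in> graphs_with_cut_edges n k \<longleftrightarrow> pverts G = {..<n} \<and> simple_rel (pverts G) (parcs G) \<and>
      connected_rel (pverts G) (parcs G) \<and> card (cut_edges G) = k"
    unfolding graphs_with_cut_edges_def mem_Collect_eq
    using pair_graph_iff[of G] connected_iff_connected_rel[of G] by blast
  show ?thesis
  proof (cases "pverts G = {..<n}")
    case True
    show ?thesis using mem ** unfolding True by blast
  qed (use mem in blast)
qed

section \<open>The edge bound and its equality case\<close>

lemma sum_excess_bound: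
  fixes c :: "'b \<Rightarrow> nat"
  assumes fin: "finite P" and pos: "\<And>X. X \<in> P \<Longrightarrow> 1 \<le> c X"
    and sum: "(\<Sum>X\<in>P. c X) = card P + s"
  shows "(\<Sum>X\<in>P. c X * (c X - 1)) \<le> (s + 1) * s"
    and "(\<Sum>X\<in>P. c X * (c X - 1)) = (s + 1) * s \<Longrightarrow> 1 \<le> s \<Longrightarrow> \<exists>X\<in>P. c X = s + 1"
proof -
  \<comment> \<open>In terms of the excesses \<open>x X\<close>, which add up to \<open>s\<close>,
    the sum is that of their squares plus \<open>s\<close>. Each square is at most
    \<open>s * x X\<close>, and equality forces every excess to be 0 or \<open>s\<close>.\<close>
  define x where "x X = c X - 1" for X
  have c: "c X = x X + 1" if "X \<in> P" for X using pos[OF that] by (simp add: x_def)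
  have sx: "(\<Sum>X\<in>P. x X) = s" using sum by (simp add: c sum_Suc)
  have le: "x X \<le> s" if "X \<in> P" for X using member_le_sum[of X P x] fin that sx by simp
  have eq: "(\<Sum>X\<in>P. c X * (c X - 1)) = (\<Sum>X\<in>P. x X * x X) + s"
    using sx by (simp add: c algebra_simps sum.distrib)
  have s2: "s * s = (\<Sum>X\<in>P. s * x X)" by (simp add: sx flip: sum_distrib_left)
  have pw: "x X * x X \<le> s * x X" if "X \<in> P" for X using le[OF that] by simp
  have "(\<Sum>X\<in>P. x X * x X) \<le> s * s" unfolding s2 using pw by (intro sum_mono)
  then show "(\<Sum>X\<in>P. c X * (c X - 1)) \<le> (s + 1) * s" unfolding eq by simp
  assume "(\<Sum>X\<in>P. c X * (c X - 1)) = (s + 1) * s" and s: "1 \<le> s"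
  then have tot: "(\<Sum>X\<in>P. x X * x X) = (\<Sum>X\<in>P. s * x X)" unfolding eq s2[symmetric] by simp
  have pt: "x X * x X = s * x X" if "X \<in> P" for X
    using sum_mono_inv[OF tot pw that fin] .
  obtain X where "X \<in> P" "x X \<noteq> 0" using sx s by (metis not_one_le_zero sum.neutral)
  then show "\<exists>X\<in>P. c X = s + 1" using pt[of X] c[of X] by (intro bexI[of _ X]) auto
qed

text \<open>\<open>N\<close> lies in the disjoint union \<open>F\<close> of the complete graphs on
  its components. At the maximum \<open>N = F\<close>, and one component has absorbed the whole
  excess \<open>s\<close> of vertices over components.\<close>

lemma simple_rel_component_bound:
  assumes simple: "simple_rel V N" and card: "card V = card (components V N) + s"
  shows "card N \<le> (s + 1) * s"
    and "card N = (s + 1) * s \<Longrightarrow> 1 \<le> s \<Longrightarrow>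
      \<exists>Q\<subseteq>V. card Q = s + 1 \<and> (\<forall>a\<in>Q. \<forall>b\<in>Q. a \<noteq> b \<longrightarrow> (a, b) \<in> N)"
proof -
  let ?P = "components V N"
  have fin: "finite V" and sub: "N \<subseteq> V \<times> V" and sym: "sym N" and irr: "irrefl N"
    using simple by (auto simp: simple_rel_def)
  have finP: "finite ?P" using fin by (simp add: components_def)
  have finX: "finite X" "X \<noteq> {}" "X \<subseteq> V" if "X \<in> ?P" for X
    using that fin by (auto simp: components_def component_def)
  have disj: "X \<inter> Y = {}" if "X \<in> ?P" "Y \<in> ?P" "X \<noteq> Y" for X Y
  proof (rule ccontr)
    assume "X \<inter> Y \<noteq> {}"
    then obtain w where w: "w \<in> X" "w \<in> Y" by auto
    obtain u v where uv: "u \<in> V" "v \<in> V" "X = component V N u" "Y = component V N v"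
      using \<open>X \<in> ?P\<close> \<open>Y \<in> ?P\<close> by (auto simp: components_def)
    then have "(u, w) \<in> N\<^sup>*" "(v, w) \<in> N\<^sup>*" using w by (auto simp: component_def)
    then have "(u, v) \<in> N\<^sup>*" using sym_rtrancl_swap[OF sym] by (meson rtrancl_trans)
    then show False using component_eq_iff[OF sym uv(1,2)] uv \<open>X \<noteq> Y\<close> by simp
  qed
  have "V = \<Union>?P" by (auto simp: components_def component_def)
  then have sumV: "(\<Sum>X\<in>?P. card X) = card V"
    using finX disj finP by (metis card_Union_disjoint disjnt_def pairwiseI)
  have pos: "1 \<le> card X" if "X \<in> ?P" for X using finX[OF that] by (simp add: Suc_le_eq card_gt_0_iff)
  note bound = sum_excess_bound[where c = card and s = s, OF finP pos]
  define F where "F = (\<Union>X\<in>?P. SIGMA a:X. X - {a})"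
  have "card F = (\<Sum>X\<in>?P. card (SIGMA a:X. X - {a}))"
    unfolding F_def
  proof (rule card_UN_disjoint)
    show "\<forall>X\<in>?P. finite (SIGMA a:X. X - {a})" using finX by auto
    show "\<forall>X\<in>?P. \<forall>Y\<in>?P. X \<noteq> Y \<longrightarrow> (SIGMA a:X. X - {a}) \<inter> (SIGMA a:Y. Y - {a}) = {}"
      using disj by blast
  qed (rule finP)
  also have "\<dots> = (\<Sum>X\<in>?P. card X * (card X - 1))"
    using finX by (intro sum.cong refl) simp
  finally have cardF: "card F = (\<Sum>X\<in>?P. card X * (card X - 1))" .
  have finF: "finite F" unfolding F_def using finP finX by auto
  have NF: "N \<subseteq> F"
  proof clarify
    fix a b assume ab: "(a, b) \<in> N"
    then have "a \<in> V" "b \<in> V" "a \<noteq> b" using sub irr by (auto simp: irrefl_def)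
    then have "component V N a \<in> ?P" "a \<in> component V N a" "b \<in> component V N a - {a}"
      using ab by (auto simp: components_def component_def)
    then show "(a, b) \<in> F" unfolding F_def by blast
  qed
  have le: "card F \<le> (s + 1) * s" using bound(1) card sumV cardF by simp
  then show "card N \<le> (s + 1) * s" using card_mono[OF finF NF] by linarith
  assume eq: "card N = (s + 1) * s" and s: "1 \<le> s"
  then have "card F = (s + 1) * s" using le card_mono[OF finF NF] by linarith
  then have "N = F" using card_subset_eq[OF finF NF] eq by simp
  obtain X where X: "X \<in> ?P" "card X = s + 1"
    using bound(2) \<open>card F = (s + 1) * s\<close> card sumV cardF s by auto
  then show "\<exists>Q\<subseteq>V. card Q = s + 1 \<and> (\<forall>a\<in>Q. \<forall>b\<in>Q. a \<noteq> b \<longrightarrow> (a, b) \<in> N)"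
  proof (intro exI[of _ X] conjI ballI impI)
    fix a b assume "a \<in> X" "b \<in> X" "a \<noteq> b"
    then have "(a, b) \<in> F" unfolding F_def using X(1) by blast
    then show "(a, b) \<in> N" using \<open>N = F\<close> by blast
  qed (use X finX in auto)
qed

text \<open>Each vertex outside \<open>Q\<close> gets a neighbour closer to \<open>Q\<close> as its parent.\<close>

lemma rooted_clique_exists:
  assumes simple: "simple_rel V E" and con: "connected_rel V E"
    and Q: "Q \<subseteq> V" "Q \<noteq> {}" and clique: "\<And>a b. a \<in> Q \<Longrightarrow> b \<in> Q \<Longrightarrow> a \<noteq> b \<Longrightarrow> (a, b) \<in> E"
    and card: "card E = card Q * (card Q - 1) + 2 * card (V - Q)"
  shows "\<exists>p r. rooted_clique V Q p r \<and> E = rooted_arcs V Q p"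
proof -
  have fin: "finite V" and sub: "E \<subseteq> V \<times> V" and sym: "sym E"
    using simple by (auto simp: simple_rel_def)
  define r where "r v = (LEAST i. \<exists>q\<in>Q. (q, v) \<in> E ^^ i)" for v
  have "\<exists>y. (y, v) \<in> E \<and> r y < r v" if v: "v \<in> V - Q" for v
  proof -
    obtain q where "q \<in> Q" using Q by auto
    then have "(q, v) \<in> E\<^sup>*" using con v Q by (auto simp: connected_rel_def)
    then obtain i where "(q, v) \<in> E ^^ i" using rtrancl_power by blast
    then have "\<exists>q\<in>Q. (q, v) \<in> E ^^ r v" 
      unfolding r_def using \<open>q \<in> Q\<close> LeastI_ex[of "\<lambda>i. \<exists>q\<in>Q. (q, v) \<in> E ^^ i"] by blast
    then obtain q where q: "q \<in> Q" "(q, v) \<in> E ^^ r v" by blast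
    have "r v \<noteq> 0" using q v by (auto intro: gr0I)
    then obtain j where j: "r v = Suc j" using not0_implies_Suc by blast
    then obtain y where y: "(q, y) \<in> E ^^ j" "(y, v) \<in> E" using q by auto
    have "r y \<le> j" unfolding r_def using q(1) y(1) by (intro Least_le) blast
    then show ?thesis using y j by auto
  qed
  then obtain p where p: "\<And>v. v \<in> V - Q \<Longrightarrow> (p v, v) \<in> E \<and> r (p v) < r v" by metis
  interpret rooted_clique V Q p r
    using fin Q p sub by unfold_locales auto
  \<comment> \<open>The clique and the parent arcs already account for \<open>card E\<close> arcs,
    so the count leaves no room for any other.\<close>
  have "rooted_arcs V Q p \<subseteq> E"
    using clique p symD[OF sym] by (auto simp: rooted_arcs_def)
  moreover have "finite E" using fin sub by (auto intro: finite_subset)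
  ultimately have "rooted_arcs V Q p = E"
    using card_arcs card by (intro card_subset_eq) auto
  then show ?thesis using rooted_clique_axioms by auto
qed

text \<open>Without its bridges the graph has \<open>k + 1\<close> components on
  \<open>k + m\<close> vertices, hence excess \<open>m - 1\<close>.\<close>

lemma arc_bound:
  assumes simple: "simple_rel V E" and con: "connected_rel V E"
    and bridges: "card (bridges E) = 2 * k" and k: "card V = k + m" "1 \<le> m"
  shows "card E \<le> m * (m - 1) + 2 * k" "m \<noteq> 2"
    and "card E = m * (m - 1) + 2 * k \<Longrightarrow>
      2 \<le> m \<Longrightarrow> \<exists>Q\<subseteq>V. card Q = m \<and> (\<forall>a\<in>Q. \<forall>b\<in>Q. a \<noteq> b \<longrightarrow> (a, b) \<in> E)"
    and "m = 1 \<Longrightarrow> card E = 2 * k"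
proof -
  let ?B = "bridges E"
  define N where "N = E - ?B"
  have finV: "finite V" and sub: "E \<subseteq> V \<times> V" and sym: "sym E" and irr: "irrefl E"
    using simple by (auto simp: simple_rel_def)
  have finE: "finite E" using finV sub by (auto intro: finite_subset)
  have BE: "?B \<subseteq> E" by (auto simp: bridges_def)
  have symB: "sym ?B" by (rule sym_bridges[OF sym])
  have simpleN: "simple_rel V N"
    using simple symB by (auto simp: N_def simple_rel_def sym_def irrefl_def)
  have compN: "card (components V N) = k + 1"
    using card_components_remove_bridges[OF simple subset_refl sym subset_refl symB BE]
      card_components_connected[OF con] bridges by (simp add: N_def)
  have cardE: "card E = card N + 2 * k"
    using card_Diff_subset[OF finite_subset[OF BE finE] BE] card_mono[OF finE BE] bridges
    by (simp add: N_def)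
  have "card V = card (components V N) + (m - 1)" using compN k by simp
  note bound = simple_rel_component_bound[OF simpleN this]
  have leN: "card N \<le> m * (m - 1)" using bound(1) k by simp
  then show "card E \<le> m * (m - 1) + 2 * k" using cardE by simp
  show "m = 1 \<Longrightarrow> card E = 2 * k" using leN cardE by simp
  show "\<exists>Q\<subseteq>V. card Q = m \<and> (\<forall>a\<in>Q. \<forall>b\<in>Q. a \<noteq> b \<longrightarrow> (a, b) \<in> E)"
    if eq: "card E = m * (m - 1) + 2 * k" and m: "2 \<le> m"
  proof -
    have "card N = (m - 1 + 1) * (m - 1)" "1 \<le> m - 1" using eq cardE m by auto
    from bound(2)[OF this] obtain Q where
      "Q \<subseteq> V" "card Q = m - 1 + 1" "\<forall>a\<in>Q. \<forall>b\<in>Q. a \<noteq> b \<longrightarrow> (a, b) \<in> N"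
      by blast
    then show ?thesis using m by (intro exI[of _ Q]) (auto simp: N_def)
  qed
  \<comment> \<open>For \<open>m = 2\<close> the non-bridges would form a single edge: at most two
    arcs by the bound, and not none, as \<open>k + 1\<close> components on \<open>k + 2\<close>
    vertices are not all singletons. Deleting that edge keeps the graph connected, so deleting the
    bridges as well yields \<open>k + 1\<close> components, although no arc is left on
    \<open>k + 2\<close> vertices.\<close>
  show "m \<noteq> 2"
  proof
    assume m: "m = 2"
    have empty: "card (components V {}) = card V"
      by (simp add: components_empty card_image inj_on_def)
    have "N \<noteq> {}" using compN empty k m by auto
    then obtain a b where ab: "(a, b) \<in> N" by auto
    then have "(b, a) \<in> N" "(a, b) \<noteq> (b, a)"
      using simpleN by (auto simp: simple_rel_def irrefl_def dest: symD)
    then have "N = {(a, b), (b, a)}"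
      using leN m ab simpleN finite_subset[of N E] finE
      by (intro card_seteq[symmetric]) (auto simp: N_def)
    then have rem: "(E - {(a, b), (b, a)}) - ?B = {}" unfolding N_def by blast
    have conE: "card (components V (E - {(a, b), (b, a)})) = 1"
      using components_remove_nonbridge[OF sym, of a b V] ab card_components_connected[OF con]
      by (auto simp: N_def bridges_def)
    have "2 * card (components V ((E - {(a, b), (b, a)}) - ?B)) =
        2 * card (components V (E - {(a, b), (b, a)})) + card ?B"
    proof (rule card_components_remove_bridges[OF simple])
      show "sym (E - {(a, b), (b, a)})" using sym by (auto simp: sym_def)
      show "?B \<subseteq> E - {(a, b), (b, a)}" using BE ab \<open>(b, a) \<in> N\<close> unfolding N_def by blast
    qed (use symB in auto)
    then have "2 * card V = 2 * 1 + 2 * k" unfolding rem conE bridges empty .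
    then show False using k m by simp
  qed
qed

section \<open>Sums of squared degrees\<close>

context rooted_clique
begin

lemma simple_arcs: "simple_rel V E"
  using finite_V arcs_subset sym_arcs irrefl_arcs by (simp add: simple_rel_def)

lemma connected_rel_arcs: "connected_rel V E"
  using connected_arcs Q_subset Q_nonempty by (auto simp: connected_rel_def)

text \<open>A clique on two vertices must be excluded, since its edge would be a further bridge;
  from three vertices on, a third vertex provides a detour.\<close>

lemma card_bridges:
  assumes "card Q \<noteq> 2"
  shows "card (bridges E) = 2 * card (V - Q)"
proof -
  let ?K = "SIGMA a:Q. Q - {a}"
  have clique: "(a, b) \<notin> bridges E" if "a \<in> Q" "b \<in> Q" "a \<noteq> b" for a b
  proof -
    have "card {a, b} \<le> card Q" using that finite_Q by (intro card_mono) auto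
    then have "3 \<le> card Q" using that assms by simp
    then show ?thesis using clique_arc_not_bridge[OF that] by (simp add: bridges_def)
  qed
  have parent: "(v, p v) \<in> bridges E" if "v \<in> V - Q" for v
    using parent_arc_bridge[OF that] that by (auto simp: bridges_def rooted_arcs_def)
  then have parent': "(p v, v) \<in> bridges E" if "v \<in> V - Q" for v
    using sym_bridges[OF sym_arcs] that by (meson symD)
  have "bridges E = E - ?K"
  proof (intro equalityI subrelI)
    fix a b assume "(a, b) \<in> bridges E"
    then show "(a, b) \<in> E - ?K" using clique by (auto simp: bridges_def)
  next
    fix a b assume "(a, b) \<in> E - ?K"
    then consider "a \<in> V - Q" "b = p a" | "b \<in> V - Q" "a = p b" by (auto simp: rooted_arcs_def)
    then show "(a, b) \<in> bridges E" using parent parent' by cases auto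
  qed
  moreover have "?K \<subseteq> E" by (auto simp: rooted_arcs_def)
  moreover have "card ?K = card Q * (card Q - 1)" "finite ?K" using finite_Q by simp_all
  ultimately have "card (bridges E) = card E - card Q * (card Q - 1)"
    by (simp only: card_Diff_subset)
  then show ?thesis unfolding card_arcs by simp
qed

lemma children_full:
  assumes "card (V - Q) \<le> children v" "x \<in> V - Q"
  shows "p x = v"
proof -
  have "{x \<in> V - Q. p x = v} = V - Q"
    using assms(1) finite_V by (intro card_seteq) (auto simp: children_def)
  then show ?thesis using assms(2) by blast
qed

lemma children_almost:
  assumes "children u + 1 = card (V - Q)"
  shows "\<exists>w\<in>V - Q. p w \<noteq> u \<and> (\<forall>x\<in>V - Q - {w}. p x = u)"
proof -
  have "card (V - Q) = card {x \<in> V - Q. p x = u} + card {x \<in> V - Q. p x \<noteq> u}"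
    using finite_V by (subst card_Un_disjoint[symmetric]) (auto intro!: arg_cong[of _ _ card])
  then have "card {x \<in> V - Q. p x \<noteq> u} = 1" using assms by (simp add: children_def)
  then obtain w where "{x \<in> V - Q. p x \<noteq> u} = {w}" using card_1_singletonE by blast
  then show ?thesis by blast
qed

definition star_at :: "'a \<Rightarrow> bool" where
  "star_at u \<longleftrightarrow> u \<in> Q \<and> (\<forall>x\<in>V - Q. p x = u)"

text \<open>Unlike in \<open>star_at\<close>, the centre \<open>u\<close> may lie outside
  \<open>Q\<close>: \<open>weight_clique_less\<close> has to deal with such brooms too.\<close>

definition broom_at :: "'a \<Rightarrow> 'a \<Rightarrow> bool" where
  "broom_at u w \<longleftrightarrow> w \<in> V - Q \<and> p w \<noteq> u \<and> (\<forall>x\<in>V - Q - {w}. p x = u)"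

lemma sum_children_star:
  assumes "star_at u"
  shows "(\<Sum>v\<in>V. (children v)\<^sup>2) = (card (V - Q))\<^sup>2"
    and "(\<Sum>v\<in>S. children v) = card (V - Q) * of_bool (u \<in> S \<and> finite S)"
proof -
  have c: "children v = (if v = u then card (V - Q) else 0)" for v
  proof -
    have "{x \<in> V - Q. p x = v} = (if v = u then V - Q else {})"
      using assms by (auto simp: star_at_def)
    then show ?thesis by (simp add: children_def)
  qed
  show "(\<Sum>v\<in>S. children v) = card (V - Q) * of_bool (u \<in> S \<and> finite S)"
    by (cases "finite S") (simp_all add: c)
  have "u \<in> V" using assms Q_subset by (auto simp: star_at_def)
  moreover have "(\<Sum>v\<in>V. (children v)\<^sup>2) = (\<Sum>v\<in>V. if v = u then (card (V - Q))\<^sup>2 else 0)"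
    by (intro sum.cong refl) (simp add: c)
  ultimately show "(\<Sum>v\<in>V. (children v)\<^sup>2) = (card (V - Q))\<^sup>2" using finite_V by simp
qed

lemma children_broom:
  assumes "broom_at u w"
  shows "children v = (card (V - Q) - 1) * of_bool (v = u) + of_bool (v = p w)"
proof -
  have w: "w \<in> V - Q" "p w \<noteq> u" and u: "\<And>x. x \<in> V - Q \<Longrightarrow> x \<noteq> w \<Longrightarrow> p x = u"
    using assms by (auto simp: broom_at_def)
  consider "v = u" | "v = p w" | "v \<noteq> u" "v \<noteq> p w" by blast
  then show ?thesis
  proof cases
    case 1
    then have "{x \<in> V - Q. p x = v} = V - Q - {w}" using w u by blast
    then show ?thesis using 1 w finite_V by (simp add: children_def)
  next
    case 2
    then have "{x \<in> V - Q. p x = v} = {w}" using w u by fastforce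
    then show ?thesis using 2 w by (simp add: children_def)
  next
    case 3
    then have empty: "{x \<in> V - Q. p x = v} = {}" using u by blast
    show ?thesis unfolding children_def empty using 3 by simp
  qed
qed

lemma sum_children_broom:
  assumes "broom_at u w" "finite S"
  shows "(\<Sum>v\<in>S. children v) = (card (V - Q) - 1) * of_bool (u \<in> S) + of_bool (p w \<in> S)"
  unfolding children_broom[OF assms(1)] sum.distrib
  using assms(2) by (simp add: of_bool_def if_distrib cong: if_cong)

lemma sum_children_squares_broom:
  assumes "broom_at u w" "u \<in> V"
  shows "(\<Sum>v\<in>V. (children v)\<^sup>2) = (card (V - Q) - 1)\<^sup>2 + 1"
proof -
  have "p w \<noteq> u" "p w \<in> V" using assms parent_in by (auto simp: broom_at_def)
  have "(\<Sum>v\<in>V. (children v)\<^sup>2) =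
      (\<Sum>v\<in>V. (card (V - Q) - 1)\<^sup>2 * of_bool (v = u) + of_bool (v = p w))"
    using \<open>p w \<noteq> u\<close> by (intro sum.cong refl) (auto simp: children_broom[OF assms(1)])
  also have "\<dots> = (card (V - Q) - 1)\<^sup>2 + 1"
    unfolding sum.distrib
    using finite_V assms(2) \<open>p w \<in> V\<close> by (simp add: of_bool_def if_distrib cong: if_cong)
  finally show ?thesis .
qed

lemma weight_star:
  assumes "star_at u"
  shows "weight = 2 * (card Q - 1) * card (V - Q) + (card (V - Q))\<^sup>2"
  using assms finite_V finite_Q by (simp add: weight_def sum_children_star[OF assms] star_at_def)

text \<open>The two cases are the second last graphs for cliques and for trees. The summand 2 is the
  linear contribution of \<open>w\<close> when it hangs outside the clique.\<close>

lemma weight_broom: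
  assumes "broom_at u w" "u \<in> Q" "2 \<le> card (V - Q)"
  shows "p w \<in> Q \<Longrightarrow> weight = 2 * (card Q - 1) * card (V - Q) + (card (V - Q) - 1)\<^sup>2 + 1"
    and "p w \<notin> Q \<Longrightarrow>
      weight = 2 * (card Q - 1) * (card (V - Q) - 1) + 2 + (card (V - Q) - 1)\<^sup>2 + 1"
proof -
  have "u \<in> V" "p w \<in> V" using assms Q_subset parent_in by (auto simp: broom_at_def)
  then show "p w \<in> Q \<Longrightarrow> weight = 2 * (card Q - 1) * card (V - Q) + (card (V - Q) - 1)\<^sup>2 + 1"
    "p w \<notin> Q \<Longrightarrow>
      weight = 2 * (card Q - 1) * (card (V - Q) - 1) + 2 + (card (V - Q) - 1)\<^sup>2 + 1"
    using assms finite_V finite_Q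
    by (simp_all add: weight_def sum_children_squares_broom[OF assms(1)]
        sum_children_broom[OF assms(1)])
qed

lemma sum_children_squares_le:
  assumes "finite S" "\<And>v. v \<in> S \<Longrightarrow> children v \<le> M"
  shows "(\<Sum>v\<in>S. (children v)\<^sup>2) \<le> M * (\<Sum>v\<in>S. children v)"
  unfolding sum_distrib_left power2_eq_square
  using assms by (intro sum_mono mult_right_mono) auto

text \<open>A vertex that is the parent of all of \<open>V - Q\<close> would be its own parent
  outside \<open>Q\<close>, and is the centre of a star inside \<open>Q\<close>.\<close>

lemma children_le_if_not_star:
  assumes "\<And>u. \<not> star_at u" "v \<in> V" "1 \<le> card (V - Q)"
  shows "children v \<le> card (V - Q) - 1"
proof (rule ccontr)
  assume "\<not> ?thesis"
  then have *: "p x = v" if "x \<in> V - Q" for x using children_full that by simp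
  then have "v \<notin> Q" using assms(1) by (auto simp: star_at_def)
  then show False using * parent_neq assms(2) by blast
qed

text \<open>If some vertex has all but one of the children, the squares match the target, and the
  loss comes from a child hanging outside \<open>Q\<close>, which contributes 2 instead of
  \<open>2 * (card Q - 1)\<close>. Otherwise the squares themselves are too small.\<close>

lemma weight_clique_less:
  assumes Q: "3 \<le> card Q" and k: "2 \<le> card (V - Q)" and nostar: "\<And>u. \<not> star_at u"
    and nobroom: "\<And>u w. u \<in> Q \<Longrightarrow> p w \<in> Q \<Longrightarrow> \<not> broom_at u w"
  shows "weight < 2 * (card Q - 1) * card (V - Q) + (card (V - Q) - 1)\<^sup>2 + 1"
proof -
  define m where "m = card Q - 1"
  define k where "k = card (V - Q)"
  define K where "K = (\<Sum>v\<in>Q. children v)"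
  define L where "L = (\<Sum>v\<in>V - Q. children v)"
  have m2: "2 \<le> m" and k2: "2 \<le> k" using Q k by (auto simp: m_def k_def)
  have KL: "K + L = k" using sum_children sum_split[of children] by (simp add: K_def L_def k_def)
  have w: "weight = 2 * m * K + 2 * L + (\<Sum>v\<in>V. (children v)\<^sup>2)"
    by (simp add: weight_def m_def K_def L_def)
  have lin: "2 * m * K + 2 * L \<le> 2 * m * k"
    using m2 by (simp add: KL[symmetric] distrib_left)
  have "weight < 2 * m * k + (k - 1)\<^sup>2 + 1"
  proof (cases "\<exists>u\<in>V. children u = k - 1")
    case True
    then obtain u where u: "u \<in> V" "children u = k - 1" by blast
    then have "children u + 1 = card (V - Q)" using k2 by (simp add: k_def)
    from children_almost[OF this] obtain w where broom: "broom_at u w" by (auto simp: broom_at_def)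
    have sq: "(\<Sum>v\<in>V. (children v)\<^sup>2) = (k - 1)\<^sup>2 + 1"
      using sum_children_squares_broom[OF broom u(1)] by (simp add: k_def)
    have "L = (k - 1) * of_bool (u \<in> V - Q) + of_bool (p w \<in> V - Q)"
      unfolding L_def k_def using finite_V by (intro sum_children_broom[OF broom]) auto
    moreover have "u \<notin> Q \<or> p w \<notin> Q" using nobroom broom by blast
    moreover have "p w \<in> V" using broom parent_in by (auto simp: broom_at_def)
    ultimately have "1 \<le> L" using k2 u(1) by (auto split: if_splits)
    then have "2 * m * K + 2 * L < 2 * m * k"
      using m2 by (simp add: KL[symmetric] distrib_left)
    then show ?thesis unfolding w sq by simp
  next
    case False
    have "children v \<le> k - 2" if "v \<in> V" for v
      using children_le_if_not_star[OF nostar that] False that k2 by (fastforce simp: k_def)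
    then have "(\<Sum>v\<in>V. (children v)\<^sup>2) \<le> (k - 2) * k"
      using sum_children_squares_le[OF finite_V, of "k - 2"] sum_children by (simp add: k_def)
    \<comment> \<open>The product k(k - 2) is (k - 1)^2 - 1; writing \<open>k = j + 2\<close>
      removes the truncated subtractions.\<close>
    also obtain j where "k = j + 2" using k2 by (metis add.commute le_iff_add)
    then have "(k - 2) * k < (k - 1)\<^sup>2 + 1" by (simp add: power2_eq_square)
    finally show ?thesis using lin unfolding w by simp
  qed
  then show ?thesis by (simp add: m_def k_def)
qed

text \<open>A star with at least three edges rooted at a leaf meets every assumption but
  \<open>max\<close> and violates the bound. With \<open>max\<close>, the root has at most
  \<open>k - 2\<close> children and all other vertices have fewer than the root.\<close>

lemma weight_tree_less:
  assumes Q: "Q = {c}" and k: "2 \<le> card (V - Q)" and nostar: "\<And>u. \<not> star_at u"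
    and nobroom: "\<And>w. \<not> broom_at c w"
    and max: "\<And>v. v \<in> V \<Longrightarrow> deg E v \<le> deg E c"
  shows "weight < 2 + (card (V - Q) - 1)\<^sup>2 + 1"
proof -
  define k where "k = card (V - Q)"
  define K where "K = children c"
  define L where "L = (\<Sum>v\<in>V - Q. children v)"
  have KL: "K + L = k"
    using sum_children sum_split[of children] Q by (simp add: K_def L_def k_def)
  have cV: "c \<in> V" using Q Q_subset by simp
  have "K \<le> k - 1" using children_le_if_not_star[OF nostar cV] k by (simp add: K_def k_def)
  moreover have "K \<noteq> k - 1"
  proof
    assume "K = k - 1"
    then have "children c + 1 = card (V - Q)" using k by (simp add: K_def k_def)
    from children_almost[OF this] show False using nobroom by (auto simp: broom_at_def)
  qed
  ultimately have "K + 2 \<le> k" using k by (simp add: k_def)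
  then obtain j where j: "k = K + 2 + j" using le_Suc_ex by blast
  \<comment> \<open>The root has no parent, whereas \<open>v\<close> has one, so comparing degrees
    gives a strict inequality between child counts.\<close>
  have lt: "children v + 1 \<le> K" if "v \<in> V - Q" for v
    using max[of v] that deg_outside[OF that] deg_clique[of c] Q by (simp add: K_def)
  obtain x where "x \<in> V - Q" using k by (metis card.empty ex_in_conv not_numeral_le_zero)
  then have "1 \<le> K" using lt by fastforce
  then obtain i where i: "K = i + 1" by (metis add.commute le_Suc_ex)
  have "(\<Sum>v\<in>V - Q. (children v)\<^sup>2) \<le> i * L"
    unfolding L_def using lt i finite_V by (intro sum_children_squares_le) auto
  moreover have "weight = 2 * L + (K\<^sup>2 + (\<Sum>v\<in>V - Q. (children v)\<^sup>2))"
    unfolding weight_def L_def K_def sum_split[of "\<lambda>v. (children v)\<^sup>2"] by (simp add: Q)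
  ultimately have "weight \<le> 2 * L + (K\<^sup>2 + i * L)" by simp
  also have "L = j + 2" using KL j by simp
  \<comment> \<open>With \<open>K = i + 1\<close> and \<open>k = i + j + 3\<close>, the right side
    exceeds the left by ij + j^2 + 2j + 2.\<close>
  also have "2 * (j + 2) + (K\<^sup>2 + i * (j + 2)) < 2 + (k - 1)\<^sup>2 + 1"
    unfolding j i by (simp add: power2_eq_square algebra_simps)
  finally show ?thesis by (simp add: k_def)
qed

end

section \<open>Isomorphism with the extremal graphs\<close>

lemma isomorphicI:
  assumes G: "pair_graph G" and inj: "inj_on f (pverts G)"
    and "pverts H = f ` pverts G" "parcs H = map_prod f f ` parcs G"
  shows "isomorphic G H"
proof -
  interpret pair_graph G by (rule G)
  let ?h = "\<lparr>iso_verts = f, iso_arcs = map_prod f f, iso_head = snd, iso_tail = fst\<rparr>"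
  have "inj_on (map_prod f f) (parcs G)"
    by (rule inj_on_subset[OF map_prod_inj_on[OF inj inj]]) (auto dest: in_arcsD1 in_arcsD2)
  then have "pre_digraph.digraph_isomorphism (with_proj G) ?h"
    using inj wf_digraph_axioms by (simp add: pre_digraph.digraph_isomorphism_def)
  moreover have "with_proj H = app_iso ?h (with_proj G)"
    using assms by (simp add: with_proj_def app_iso_def)
  ultimately show ?thesis unfolding digraph_iso_def by blast
qed

lemma (in rooted_clique) rooted_arcs_image:
  assumes inj: "inj_on f V" and p': "\<And>v. v \<in> V - Q \<Longrightarrow> p' (f v) = f (p v)"
  shows "rooted_arcs (f ` V) (f ` Q) p' = map_prod f f ` E"
proof -
  have "f ` V - f ` Q = f ` (V - Q)" using inj Q_subset by (simp add: inj_on_image_set_diff)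
  moreover have "{(a, b). a \<in> f ` Q \<and> b \<in> f ` Q \<and> a \<noteq> b} =
      map_prod f f ` {(a, b). a \<in> Q \<and> b \<in> Q \<and> a \<noteq> b}" (is "?L = ?R")
  proof
    show "?R \<subseteq> ?L" using inj_on_subset[OF inj Q_subset] by (auto dest: inj_onD)
    show "?L \<subseteq> ?R"
    proof clarify
      fix a b assume "a \<in> Q" "b \<in> Q" "f a \<noteq> f b"
      then show "(f a, f b) \<in> ?R" by (intro image_eqI[of _ _ "(a, b)"]) auto
    qed
  qed
  moreover have "(\<lambda>v. (v, p' v)) ` f ` (V - Q) = map_prod f f ` (\<lambda>v. (v, p v)) ` (V - Q)"
    "(\<lambda>v. (p' v, v)) ` f ` (V - Q) = map_prod f f ` (\<lambda>v. (p v, v)) ` (V - Q)"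
    unfolding image_image using p' by (auto intro!: image_cong)
  ultimately show ?thesis by (simp add: rooted_arcs_def image_Un)
qed

text \<open>Colours record the role of a vertex, so matching the sizes of the colour classes is all
  it takes to produce an isomorphism: bijections between classes are glued together.\<close>

lemma ex_bij_betw_coloring:
  assumes fin: "finite A" "finite B"
    and card: "\<And>c. card {x \<in> A. f x = c} = card {y \<in> B. g y = c}"
  shows "\<exists>h. bij_betw h A B \<and> (\<forall>x\<in>A. g (h x) = f x)"
proof -
  have "\<exists>h. bij_betw h {x \<in> A. f x = c} {y \<in> B. g y = c}" for c
    using fin card[of c] by (intro finite_same_card_bij) auto
  then obtain h where h: "\<And>c. bij_betw (h c) {x \<in> A. f x = c} {y \<in> B. g y = c}" by metis
  define k where "k x = h (f x) x" for x
  have in_k: "k x \<in> B" "g (k x) = f x" if "x \<in> A" for x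
    using bij_betw_apply[OF h[of "f x"], of x] that by (auto simp: k_def)
  have "inj_on k A"
  proof (rule inj_onI)
    fix x y assume *: "x \<in> A" "y \<in> A" "k x = k y"
    then have "f x = f y" using in_k by metis
    then show "x = y" using * h[of "f x"] by (auto simp: bij_betw_def inj_on_def k_def)
  qed
  moreover have "B \<subseteq> k ` A"
  proof
    fix y assume "y \<in> B"
    then have "y \<in> h (g y) ` {x \<in> A. f x = g y}" using h[of "g y"] by (auto simp: bij_betw_def)
    then obtain x where "x \<in> A" "f x = g y" "y = h (g y) x" by auto
    then show "y \<in> k ` A" by (intro image_eqI[of _ _ x]) (simp_all add: k_def)
  qed
  ultimately show ?thesis using in_k by (intro exI[of _ k]) (auto simp: bij_betw_def)
qed

text \<open>In a tree that is no star some vertex other than the root has a child and hence degree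
  at least 2, so the root has at least two children, but not all of them. This bounds
  \<open>n\<close> from below.\<close>

lemma (in rooted_clique) tree_children_ge_3:
  assumes Q: "Q = {c}" and k: "2 \<le> card (V - Q)" and nostar: "\<And>u. \<not> star_at u"
    and max: "\<And>v. v \<in> V \<Longrightarrow> deg E v \<le> deg E c"
  shows "3 \<le> card (V - Q)"
proof -
  have "children c \<le> card (V - Q) - 1"
    using children_le_if_not_star[OF nostar] Q Q_subset k by simp
  moreover have "children c + (\<Sum>v\<in>V - Q. children v) = card (V - Q)"
    using sum_children sum_split[of children] by (simp add: Q)
  ultimately have "(\<Sum>v\<in>V - Q. children v) \<noteq> 0" using k by linarith
  then obtain v where v: "v \<in> V - Q" "children v \<noteq> 0" by (meson sum.neutral)
  then have "2 \<le> children c" using max[of v] deg_outside[of v] deg_clique[of c] Q by simp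
  then show ?thesis using \<open>children c \<le> _\<close> by simp
qed

lemma card_Diff_doubleton:
  assumes "finite A" "a \<noteq> b"
  shows "card (A - {a, b}) = card A - of_bool (a \<in> A) - of_bool (b \<in> A)"
proof -
  have "A - {a, b} = A - {a} - {b}" by auto
  then show ?thesis using assms by (simp add: card_Diff_singleton_if)
qed

lemma mem_rooted_arcs_iff:
  "(a, b) \<in> rooted_arcs V Q p \<longleftrightarrow>
    a \<in> Q \<and> b \<in> Q \<and> a \<noteq> b \<or> a \<in> V - Q \<and> b = p a \<or> b \<in> V - Q \<and> a = p b"
  by (auto simp: rooted_arcs_def)

lemma rooted_arcs_move_leaf:
  assumes "u \<in> Q" "v \<in> Q" "u \<noteq> v" "w \<in> V - Q"
  shows "rooted_arcs V Q (\<lambda>_. u) - {(u, w), (w, u)} \<union> {(v, w), (w, v)} =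
    rooted_arcs V Q (\<lambda>x. if x = w then v else u)" (is "?L = ?R")
proof -
  have "(a, b) \<in> ?L \<longleftrightarrow> (a, b) \<in> ?R" for a b
    using assms by (cases "a = w"; cases "b = w") (auto simp: mem_rooted_arcs_iff)
  then show ?thesis unfolding set_eq_iff split_paired_All by blast
qed

section \<open>Parent functions of the two extremal graphs\<close>

lemma parcs_clique_pendants:
  "k < n \<Longrightarrow> parcs (clique_pendants n k) = rooted_arcs {..<n} {..<n - k} (\<lambda>_. 0)"
  by (auto simp: clique_pendants_def graph_on_def rooted_arcs_def)

lemma pverts_clique_pendants: "pverts (clique_pendants n k) = {..<n}"
  by (simp add: clique_pendants_def graph_on_def)

text \<open>\<open>id\<close> serves as rank because parents carry smaller numbers than their
  children.\<close>

lemma rooted_clique_pendants: "k < n \<Longrightarrow> rooted_clique {..<n} {..<n - k} (\<lambda>_. 0) id"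
  by unfold_locales (auto simp: lessThan_empty_iff)

text \<open>One parent function serves both forms of \<open>second_last\<close>: vertex
  \<open>1\<close>, to which the last vertex is attached, lies in the clique if
  \<open>2 \<le> n - k\<close> and is a child of \<open>0\<close> if the clique is just
  \<open>{0}\<close>.\<close>

definition broom_parent :: "nat \<Rightarrow> nat \<Rightarrow> nat" where
  "broom_parent n v = (if v = n - 1 then 1 else 0)"

lemma parcs_second_last:
  assumes "1 \<le> k" "k < n" "4 \<le> n"
  shows "parcs (second_last n k) = rooted_arcs {..<n} {..<n - k} (broom_parent n)"
proof (cases "k = n - 1")
  case True
  then have *: "{..<n - k} = {0}" using assms by auto
  have "parcs (second_last n k) =
      {0} \<times> {1..n - 2} \<union> {1..n - 2} \<times> {0} \<union> {(1, n - 1), (n - 1, 1)}"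
    using True by (auto simp: second_last_def extended_star_def attach_leaf_def star_def graph_on_def)
  also have "\<dots> = rooted_arcs {..<n} {0} (broom_parent n)"
  proof -
    obtain l where "n = Suc (Suc l)" "2 \<le> l"
      using assms by (intro that[of "n - 2"]) auto
    then show ?thesis by (auto simp: mem_rooted_arcs_iff broom_parent_def split: if_splits)
  qed
  finally show ?thesis unfolding * .
next
  case False
  have "parcs (second_last n k) =
      rooted_arcs {..<n} {..<n - k} (\<lambda>_. 0) - {(0, n - 1), (n - 1, 0)} \<union> {(1, n - 1), (n - 1, 1)}"
    using False assms by (simp add: second_last_def clique_pendants_moved_def add_edge_def
        del_edge_def parcs_clique_pendants)
  also have "\<dots> = rooted_arcs {..<n} {..<n - k} (\<lambda>v. if v = n - 1 then 1 else 0)"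
    using assms False by (intro rooted_arcs_move_leaf) auto
  also have "(\<lambda>v. if v = n - 1 then 1 else 0) = broom_parent n"
    by (simp add: fun_eq_iff broom_parent_def)
  finally show ?thesis .
qed

lemma pverts_second_last: "4 \<le> n \<Longrightarrow> pverts (second_last n k) = {..<n}"
  by (auto simp: second_last_def clique_pendants_moved_def add_edge_def del_edge_def
      clique_pendants_def graph_on_def extended_star_def attach_leaf_def star_def)

lemma rooted_broom: "k < n \<Longrightarrow> 3 \<le> n \<Longrightarrow> rooted_clique {..<n} {..<n - k} (broom_parent n) id"
  by unfold_locales (auto simp: broom_parent_def lessThan_empty_iff)

context rooted_clique
begin

lemma isomorphic_if_parents_correspond:
  assumes G: "pverts G = V" "parcs G = E" and H: "pverts H = V'" "parcs H = rooted_arcs V' Q' p'"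
    and f: "bij_betw f V V'" "f ` Q = Q'" and p': "\<And>v. v \<in> V - Q \<Longrightarrow> p' (f v) = f (p v)"
  shows "isomorphic G H"
proof (rule isomorphicI)
  show "pair_graph G" unfolding pair_graph_iff G by (rule simple_arcs)
  show inj: "inj_on f (pverts G)" and V': "pverts H = f ` pverts G"
    using f(1) by (auto simp: bij_betw_def G H)
  show "parcs H = map_prod f f ` parcs G"
    using rooted_arcs_image[of f p'] p' inj V' by (simp add: G H f(2))
qed

end

lemma card_outside:
  assumes "rooted_clique {..<n} Q p r" "card Q = n - k" "k < n"
  shows "card ({..<n} - Q) = k"
proof -
  interpret rooted_clique "{..<n}" Q p r by (rule assms(1))
  show ?thesis using card_Diff_subset[OF finite_Q Q_subset] assms(2,3) by simp
qed

context
  fixes n k :: nat and G :: "nat pair_pre_digraph" and Q p r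
  assumes rooted: "rooted_clique {..<n} Q p r" and cardQ: "card Q = n - k" and kn: "k < n"
    and G: "pverts G = {..<n}" "parcs G = rooted_arcs {..<n} Q p"
begin

interpretation rooted_clique "{..<n}" Q p r by (rule rooted)

private lemmas outside = card_outside[OF rooted cardQ kn]

private lemma image_clique:
  assumes f: "bij_betw f {..<n} {..<n}" and Q: "\<And>x. x \<in> Q \<Longrightarrow> f x < n - k"
  shows "f ` Q = {..<n - k}"
proof (rule card_subset_eq)
  have "inj_on f Q" using f Q_subset by (auto simp: bij_betw_def intro: inj_on_subset)
  then show "card (f ` Q) = card {..<n - k}" using cardQ by (simp add: card_image)
qed (use Q in auto)

lemma isomorphic_clique_pendants:
  assumes star: "star_at u"
  shows "isomorphic G (clique_pendants n k)"
proof -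
  have u: "u \<in> Q" "\<And>x. x \<in> {..<n} - Q \<Longrightarrow> p x = u" using star by (auto simp: star_at_def)
  \<comment> \<open>Three roles: the centre, the other clique vertices, the pendant
    vertices.\<close>
  define f where "f x = (if x = u then 0 else if x \<in> Q then 1 else 2 :: nat)" for x
  define g where "g y = (if y = 0 then 0 else if y < n - k then 1 else 2 :: nat)" for y :: nat
  have "card {x \<in> {..<n}. f x = c} = card {y \<in> {..<n}. g y = c}" for c
  proof -
    have "{x \<in> {..<n}. f x = c} = (if c = 0 then {u} else if c = 1 then Q - {u}
        else if c = 2 then {..<n} - Q else {})"
      using u(1) Q_subset by (auto simp: f_def split: if_splits)
    moreover have "{y \<in> {..<n}. g y = c} = (if c = 0 then {0} else if c = 1 then {..<n - k} - {0}
        else if c = 2 then {n - k..<n} else {})"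
      using kn by (auto simp: g_def split: if_splits)
    ultimately show ?thesis using u(1) cardQ kn outside finite_Q by simp
  qed
  from ex_bij_betw_coloring[OF finite_lessThan finite_lessThan this] obtain h where
    h: "bij_betw h {..<n} {..<n}" "\<And>x. x < n \<Longrightarrow> g (h x) = f x"
    by (metis lessThan_iff)
  have gf: "h x = 0 \<longleftrightarrow> x = u" "h x < n - k \<longleftrightarrow> x \<in> Q" if "x < n" for x
    using h(2)[OF that] kn u(1) by (auto simp: f_def g_def split: if_splits)
  show ?thesis
  proof (rule isomorphic_if_parents_correspond[OF G pverts_clique_pendants
        parcs_clique_pendants[OF kn] h(1)])
    show "h ` Q = {..<n - k}" using image_clique[OF h(1)] gf Q_subset by auto
    show "0 = h (p v)" if "v \<in> {..<n} - Q" for v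
      using gf(1)[of u] u Q_subset that by auto
  qed
qed

text \<open>The equivalence assumed for \<open>p w\<close> covers both shapes at once, as vertex
  \<open>1\<close> of \<open>second_last n k\<close> lies in \<open>{..<n - k}\<close> exactly if
  \<open>2 \<le> n - k\<close>.\<close>

lemma isomorphic_second_last:
  assumes broom: "broom_at u w" and u: "u \<in> Q" and w: "p w \<in> Q \<longleftrightarrow> 2 \<le> n - k"
    and k: "1 \<le> k" and n: "4 \<le> n"
  shows "isomorphic G (second_last n k)"
proof -
  define v where "v = p w"
  have wV: "w \<in> {..<n} - Q" and vV: "v < n" and px: "\<And>x. x \<in> {..<n} - Q - {w} \<Longrightarrow> p x = u"
    using broom parent_in by (auto simp: broom_at_def v_def)
  have neq: "u \<noteq> v" "v \<noteq> w" "u \<noteq> w"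
    using broom parent_neq[of w] u by (auto simp: broom_at_def v_def)
  \<comment> \<open>Colours 0, 1, 2 single out the centre, the parent of the moved vertex and the
    moved vertex; 3 and 4 are the rest inside and outside the clique.\<close>
  define f where "f x = (if x = u then 0 else if x = v then 1 else if x = w then 2
      else if x \<in> Q then 3 else 4 :: nat)" for x
  define g where "g y = (if y = 0 then 0 else if y = 1 then 1 else if y = n - 1 then 2
      else if y < n - k then 3 else 4 :: nat)" for y :: nat
  have "card {x \<in> {..<n}. f x = c} = card {y \<in> {..<n}. g y = c}" for c
  proof -
    have clique: "card (Q - {u, v}) = card ({..<n - k} - {0, 1})"
      unfolding card_Diff_doubleton[OF finite_Q neq(1)] card_Diff_doubleton[OF finite_lessThan zero_neq_one]
      using u w cardQ kn by (simp add: v_def)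
    have rest: "card ({..<n} - Q - {v, w}) = card ({n - k..<n} - {1, n - 1})"
    proof -
      have "card ({..<n} - Q - {v, w}) =
          card ({..<n} - Q) - of_bool (v \<in> {..<n} - Q) - of_bool (w \<in> {..<n} - Q)"
        using neq by (intro card_Diff_doubleton) auto
      moreover have "card ({n - k..<n} - {1, n - 1}) =
          card {n - k..<n} - of_bool (1 \<in> {n - k..<n}) - of_bool (n - 1 \<in> {n - k..<n})"
        using n by (intro card_Diff_doubleton) auto
      moreover have "n - k \<le> n - 1" using k by simp
      ultimately show ?thesis using w wV vV kn k n outside by (simp add: v_def)
    qed
    consider "c = 0" | "c = 1" | "c = 2" | "c = 3" | "c = 4" | "4 < c" by linarith
    then show ?thesis
    proof cases
      case 1
      have "{x \<in> {..<n}. f x = c} = {u}" using 1 u Q_subset wV vV neq by (auto simp: f_def)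
      moreover have "{y \<in> {..<n}. g y = c} = {0}" using 1 kn k n by (auto simp: g_def)
      ultimately show ?thesis by simp
    next
      case 2
      have "{x \<in> {..<n}. f x = c} = {v}" using 2 u Q_subset wV vV neq by (auto simp: f_def)
      moreover have "{y \<in> {..<n}. g y = c} = {1}" using 2 kn k n by (auto simp: g_def)
      ultimately show ?thesis by simp
    next
      case 3
      have "{x \<in> {..<n}. f x = c} = {w}" using 3 u Q_subset wV vV neq by (auto simp: f_def)
      moreover have "{y \<in> {..<n}. g y = c} = {n - 1}" using 3 kn k n by (auto simp: g_def)
      ultimately show ?thesis by simp
    next
      case 4
      have "{x \<in> {..<n}. f x = c} = Q - {u, v}" using 4 u Q_subset wV vV neq by (auto simp: f_def)
      moreover have "{y \<in> {..<n}. g y = c} = {..<n - k} - {0, 1}" using 4 kn k n by (auto simp: g_def)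
      ultimately show ?thesis using clique by simp
    next
      case 5
      have "{x \<in> {..<n}. f x = c} = {..<n} - Q - {v, w}" using 5 u Q_subset wV vV neq by (auto simp: f_def)
      moreover have "{y \<in> {..<n}. g y = c} = {n - k..<n} - {1, n - 1}" using 5 kn k n by (auto simp: g_def)
      ultimately show ?thesis using rest by simp
    next
      case 6
      have "{x \<in> {..<n}. f x = c} = {}" using 6 u Q_subset wV vV neq by (auto simp: f_def)
      moreover have "{y \<in> {..<n}. g y = c} = {}" using 6 kn k n by (auto simp: g_def)
      ultimately show ?thesis by metis
    qed
  qed
  from ex_bij_betw_coloring[OF finite_lessThan finite_lessThan this] obtain h where
    h: "bij_betw h {..<n} {..<n}" "\<And>x. x < n \<Longrightarrow> g (h x) = f x"
    by (metis lessThan_iff)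
  have uV: "u < n" using u Q_subset by auto
  have g_iff: "g y = 0 \<longleftrightarrow> y = 0" "g y = 1 \<longleftrightarrow> y = 1" "g y = 2 \<longleftrightarrow> y = n - 1"
    "g y = 3 \<Longrightarrow> y < n - k" for y
    using n by (auto simp: g_def split: if_splits)
  have f_iff: "f u = 0" "f v = 1" "f x = 2 \<longleftrightarrow> x = w" "x \<in> Q \<Longrightarrow> x = u \<or> x = v \<or> f x = 3" for x
    using neq wV by (auto simp: f_def)
  have hu: "h u = 0" and hv: "h v = 1"
    using h(2)[OF uV] h(2)[OF vV] f_iff(1,2) g_iff(1,2) by metis+
  have hw: "h x = n - 1 \<longleftrightarrow> x = w" if "x < n" for x
    using h(2)[OF that] f_iff(3) g_iff(3) by metis
  have hQ: "h x < n - k" if "x \<in> Q" for x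
  proof -
    have "x < n" using that Q_subset by auto
    then consider "x = u" | "x = v" | "g (h x) = 3" using f_iff(4)[OF \<open>x \<in> Q\<close>] h(2) by metis
    then show ?thesis
    proof cases
      case 2
      then show ?thesis using that w hv by (simp add: v_def)
    qed (use hu kn g_iff(4) in auto)
  qed
  show ?thesis
  proof (rule isomorphic_if_parents_correspond[OF G pverts_second_last[OF n]
        parcs_second_last[OF k kn n] h(1)])
    show "h ` Q = {..<n - k}" using image_clique[OF h(1)] hQ by auto
    show "broom_parent n (h x) = h (p x)" if "x \<in> {..<n} - Q" for x
      using that hw[of x] hu hv px[of x] by (cases "x = w") (auto simp: broom_parent_def v_def)
  qed
qed

lemma mem_graphs_with_cut_edges:
  assumes "n - k \<noteq> 2"
  shows "G \<in> graphs_with_cut_edges n k"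
  using G simple_arcs connected_rel_arcs card_bridges outside cardQ assms
  unfolding mem_graphs_with_cut_edges_iff by simp

end

section \<open>Comparison in the S-order\<close>

lemma S_before_fewer_arcs:
  assumes "pverts G = {..<n}" "simple_rel {..<n} (parcs G)"
    and "pverts H = {..<n}" "simple_rel {..<n} (parcs H)"
    and "card (parcs G) < card (parcs H)" "3 \<le> n"
  shows "G \<prec>\<^sub>s H"
proof -
  have "spectral_moment i G = spectral_moment i H" if "i < 2" for i
  proof -
    from that consider "i = 0" | "i = 1" by linarith
    then show ?thesis
      using assms by cases (simp_all only: spectral_moment_0[OF _ refl] spectral_moment_1[OF _ refl])
  qed
  moreover have "spectral_moment 2 G < spectral_moment 2 H"
    using assms by (simp add: spectral_moment_2[OF _ refl])
  ultimately show ?thesis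
    using assms unfolding S_before_def by (intro conjI bexI[of _ 2]) auto
qed

text \<open>Equal clique sizes make S_0, ..., S_3 agree, so S_4 decides; \<open>5 \<le> n\<close>
  keeps the index 4 within the range of the order.\<close>

lemma S_before_weight:
  assumes G: "pverts G = {..<n}" "parcs G = rooted_arcs {..<n} Q p" "rooted_clique {..<n} Q p r"
    and H: "pverts H = {..<n}" "parcs H = rooted_arcs {..<n} Q' p'" "rooted_clique {..<n} Q' p' r'"
    and card: "card Q = card Q'" and n: "5 \<le> n"
    and less: "rooted_clique.weight {..<n} Q p < rooted_clique.weight {..<n} Q' p'"
  shows "G \<prec>\<^sub>s H"
proof -
  interpret G: rooted_clique "{..<n}" Q p r by (rule G(3))
  interpret H: rooted_clique "{..<n}" Q' p' r' by (rule H(3))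
  have out: "card ({..<n} - Q) = card ({..<n} - Q')"
    using card G.Q_subset H.Q_subset G.finite_Q H.finite_Q by (simp add: card_Diff_subset)
  note mG = G(1,2) G.simple_arcs and mH = H(1,2) H.simple_arcs
  have "spectral_moment i G = spectral_moment i H" if "i < 4" for i
  proof -
    from that consider "i = 0" | "i = 1" | "i = 2" | "i = 3" by linarith
    then show ?thesis
    proof cases
      case 1
      then show ?thesis using spectral_moment_0[OF mG] spectral_moment_0[OF mH] by simp
    next
      case 2
      then show ?thesis using spectral_moment_1[OF mG] spectral_moment_1[OF mH] by simp
    next
      case 3
      then show ?thesis
        using spectral_moment_2[OF mG] spectral_moment_2[OF mH] card out
        by (simp add: G.card_arcs H.card_arcs)
    next
      case 4
      then show ?thesis
        using spectral_moment_3[OF mG] spectral_moment_3[OF mH] card G.finite_Q H.finite_Q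
        by (simp add: G.closed_walks3_eq H.closed_walks3_eq card_triples_distinct)
    qed
  qed
  moreover have "card (closed_walks4 G.E) < card (closed_walks4 H.E)"
  proof -
    \<comment> \<open>Naming the products as single variables leaves a linear problem.\<close>
    have "a < b" if "a + x = 2 * (y + w) + z" "b + x = 2 * (y + w') + z" "w < w'"
      for a b x y z w w' :: nat using that by presburger
    from this[OF _ H.card_closed_walks4_eq less] show ?thesis
      using G.card_closed_walks4_eq unfolding card out by blast
  qed
  then have "spectral_moment 4 G < spectral_moment 4 H"
    using spectral_moment_4[OF mG] spectral_moment_4[OF mH] by simp
  ultimately show ?thesis
    using G(1) H(1) n unfolding S_before_def by (intro conjI bexI[of _ 4]) auto
qed

lemma rooted_clique_of_extremal:
  assumes G: "G \<in> graphs_with_cut_edges n k" and kn: "k < n"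
    and eq: "card (parcs G) = (n - k) * (n - k - 1) + 2 * k"
  obtains Q p r where "rooted_clique {..<n} Q p r" "card Q = n - k" "parcs G = rooted_arcs {..<n} Q p"
    "n - k = 1 \<Longrightarrow> \<exists>c. Q = {c} \<and> (\<forall>v<n. deg (parcs G) v \<le> deg (parcs G) c)"
proof -
  let ?E = "parcs G"
  have simple: "simple_rel {..<n} ?E" and con: "connected_rel {..<n} ?E"
    and br: "card (bridges ?E) = 2 * k"
    using G by (auto simp: mem_graphs_with_cut_edges_iff)
  obtain Q where Q: "Q \<subseteq> {..<n}" "card Q = n - k" "\<forall>a\<in>Q. \<forall>b\<in>Q. a \<noteq> b \<longrightarrow> (a, b) \<in> ?E"
    "n - k = 1 \<Longrightarrow> \<exists>c. Q = {c} \<and> (\<forall>v<n. deg ?E v \<le> deg ?E c)"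
  proof (cases "n - k = 1")
    case True
    \<comment> \<open>In a tree any single vertex is a clique of the right size; one of maximal
      degree is chosen for the weight comparison.\<close>
    have "Max (deg ?E ` {..<n}) \<in> deg ?E ` {..<n}" using kn by (intro Max_in) auto
    then obtain c where "c < n" "deg ?E c = Max (deg ?E ` {..<n})" by auto
    then show ?thesis using True by (intro that[of "{c}"]) auto
  next
    case False
    then have "2 \<le> n - k" using kn by simp
    then show ?thesis
      using arc_bound(3)[OF simple con br, of "n - k"] eq kn that False by auto
  qed
  have "Q \<noteq> {}" using Q(2) kn by auto
  moreover have "card ({..<n} - Q) = k"
    using Q(1,2) kn finite_subset[OF Q(1)] by (simp add: card_Diff_subset)
  ultimately obtain p r where "rooted_clique {..<n} Q p r" "?E = rooted_arcs {..<n} Q p"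
    using rooted_clique_exists[OF simple con Q(1)] Q eq by auto
  then show ?thesis using that Q by blast
qed

theorem theorem2p2:
  fixes n k :: nat
  assumes "2 \<le> k" and "k \<le> n - 1"
    and "\<exists>G\<in>graphs_with_cut_edges n k. \<not> isomorphic G (clique_pendants n k)"
    and "(n, k) \<noteq> (4, 3)"
  shows "second_last n k \<in> graphs_with_cut_edges n k \<and>
    second_last n k \<prec>\<^sub>s clique_pendants n k \<and>
    (\<forall>G\<in>graphs_with_cut_edges n k.
       \<not> isomorphic G (clique_pendants n k) \<and> \<not> isomorphic G (second_last n k) \<longrightarrow>
       G \<prec>\<^sub>s second_last n k)"
proof -
  define m where "m = n - k"
  have kn: "k < n" and m1: "1 \<le> m" using assms(1,2) by (auto simp: m_def)
  have cardV: "card {..<n} = k + m" using kn by (simp add: m_def)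
  obtain G0 where G0: "G0 \<in> graphs_with_cut_edges n k" "\<not> isomorphic G0 (clique_pendants n k)"
    using assms(3) by blast
  have bound: "card (parcs G) \<le> m * (m - 1) + 2 * k" "m \<noteq> 2" "m = 1 \<Longrightarrow> card (parcs G) = 2 * k"
    if "G \<in> graphs_with_cut_edges n k" for G
    using that arc_bound[of "{..<n}" "parcs G" k m] cardV m1
    unfolding mem_graphs_with_cut_edges_iff by blast+
  have m2: "m \<noteq> 2" using bound(2) G0(1) .
  \<comment> \<open>For \<open>m = 1\<close> a tree other than the star forces
    \<open>k \<ge> 3\<close>, so only the excluded pair has fewer than five vertices; otherwise
    \<open>m \<ge> 3\<close> and \<open>k \<ge> 2\<close>.\<close>
  have n5: "5 \<le> n"
  proof (cases "m = 1")
    case True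
    then have "card (parcs G0) = (n - k) * (n - k - 1) + 2 * k"
      using bound(3)[OF G0(1)] by (simp add: m_def)
    then obtain Q p r where Q: "rooted_clique {..<n} Q p r" "card Q = n - k"
      "parcs G0 = rooted_arcs {..<n} Q p"
      "n - k = 1 \<Longrightarrow> \<exists>c. Q = {c} \<and> (\<forall>v<n. deg (parcs G0) v \<le> deg (parcs G0) c)"
      using rooted_clique_of_extremal[OF G0(1) kn] by blast
    interpret rooted_clique "{..<n}" Q p r by (rule Q(1))
    have G0V: "pverts G0 = {..<n}" using G0(1) by (simp add: mem_graphs_with_cut_edges_iff)
    note out = card_outside[OF Q(1,2) kn]
    have "\<not> star_at u" for u
      using isomorphic_clique_pendants[OF Q(1,2) kn G0V Q(3)] G0(2) by blast
    moreover obtain c where "Q = {c}" "\<forall>v<n. deg (parcs G0) v \<le> deg (parcs G0) c"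
      using Q(4) True by (auto simp: m_def)
    ultimately have "3 \<le> k"
      using tree_children_ge_3[of c] assms(1) out Q(3) by simp
    then show ?thesis using True assms(4) by (auto simp: m_def)
  qed (use m1 m2 assms(1) in \<open>auto simp: m_def\<close>)
  let ?T = "second_last n k" and ?K = "clique_pendants n k" and ?p = "broom_parent n"
  have TV: "pverts ?T = {..<n}" using pverts_second_last n5 by simp
  have TE: "parcs ?T = rooted_arcs {..<n} {..<n - k} ?p"
    using parcs_second_last assms(1) kn n5 by simp
  have Tr: "rooted_clique {..<n} {..<n - k} ?p id" using rooted_broom kn n5 by simp
  have KE: "parcs ?K = rooted_arcs {..<n} {..<n - k} (\<lambda>_. 0)" using parcs_clique_pendants[OF kn] .
  have Kr: "rooted_clique {..<n} {..<n - k} (\<lambda>_. 0) id" using rooted_clique_pendants[OF kn] .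
  interpret T: rooted_clique "{..<n}" "{..<n - k}" ?p id by (rule Tr)
  interpret K: rooted_clique "{..<n}" "{..<n - k}" "\<lambda>_. 0" id by (rule Kr)
  have cardQ: "card {..<n - k} = n - k" by simp
  have out: "card ({..<n} - {..<n - k}) = k" using card_outside[OF Kr cardQ kn] .
  have broom: "T.broom_at 0 (n - 1)"
    using kn assms(1) by (auto simp: T.broom_at_def broom_parent_def)
  have weightT: "T.weight = (if m = 1 then 2 + (k - 1)\<^sup>2 + 1 else 2 * (m - 1) * k + (k - 1)\<^sup>2 + 1)"
    using T.weight_broom[OF broom] out assms(1) kn m1
    by (auto simp: m_def broom_parent_def)
  have memT: "?T \<in> graphs_with_cut_edges n k"
    using mem_graphs_with_cut_edges[OF Tr cardQ kn TV TE] m2 by (simp add: m_def)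
  moreover have "?T \<prec>\<^sub>s ?K"
  proof (rule S_before_weight[OF TV TE Tr pverts_clique_pendants KE Kr refl n5])
    have "K.weight = 2 * (m - 1) * k + k\<^sup>2"
      using K.weight_star[of 0] out kn by (simp add: K.star_at_def m_def)
    \<comment> \<open>With \<open>k = j + 2\<close> the weights differ by 2j for
      \<open>m = 1\<close> and by 2j + 2 otherwise, so the tree case needs \<open>j\<close> to be
      positive.\<close>
    moreover obtain j where j: "k = j + 2" using assms(1) by (metis add.commute le_iff_add)
    moreover have "m = 1 \<Longrightarrow> 2 \<le> j" using n5 j by (simp add: m_def)
    ultimately show "T.weight < K.weight"
      unfolding weightT by (auto simp: power2_eq_square)
  qed
  moreover have "G \<prec>\<^sub>s ?T"
    if G: "G \<in> graphs_with_cut_edges n k" "\<not> isomorphic G ?K" "\<not> isomorphic G ?T" for G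
  proof -
    have GV: "pverts G = {..<n}" "simple_rel {..<n} (parcs G)"
      using G(1) by (auto simp: mem_graphs_with_cut_edges_iff)
    have cardT: "card (parcs ?T) = m * (m - 1) + 2 * k"
      using T.card_arcs out unfolding TE by (simp add: m_def)
    show ?thesis
    proof (cases "card (parcs G) < card (parcs ?T)")
      case True
      then show ?thesis using S_before_fewer_arcs[OF GV TV _ True] T.simple_arcs n5 by (simp add: TE)
    next
      case False
      then have "card (parcs G) = (n - k) * (n - k - 1) + 2 * k"
        using bound(1)[OF G(1)] unfolding cardT m_def by linarith
      then obtain Q p r where Q: "rooted_clique {..<n} Q p r" "card Q = n - k"
        "parcs G = rooted_arcs {..<n} Q p"
        "n - k = 1 \<Longrightarrow> \<exists>c. Q = {c} \<and> (\<forall>v<n. deg (parcs G) v \<le> deg (parcs G) c)"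
        using rooted_clique_of_extremal[OF G(1) kn] by blast
      interpret rooted_clique "{..<n}" Q p r by (rule Q(1))
      note outQ = card_outside[OF Q(1,2) kn]
      have nostar: "\<not> star_at u" for u
        using isomorphic_clique_pendants[OF Q(1,2) kn GV(1) Q(3)] G(2) by blast
      have nobroom: "\<not> broom_at u w" if "u \<in> Q" "p w \<in> Q \<longleftrightarrow> 2 \<le> n - k" for u w
        using isomorphic_second_last[OF Q(1,2) kn GV(1) Q(3) _ that] G(3) n5 assms(1) by auto
      have "weight < T.weight"
      proof (cases "m = 1")
        case True
        then obtain c where c: "Q = {c}" "\<forall>v<n. deg (parcs G) v \<le> deg (parcs G) c"
          using Q(4) by (auto simp: m_def)
        \<comment> \<open>With \<open>Q = {c}\<close>, a parent different from \<open>c\<close> is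
          automatically outside the clique, as the tree form of \<open>second_last\<close>
          demands.\<close>
        have "\<not> broom_at c w" for w
        proof
          assume broom: "broom_at c w"
          then have "p w \<noteq> c" unfolding broom_at_def by blast
          then have "c \<in> Q" "p w \<in> Q \<longleftrightarrow> 2 \<le> n - k" using c(1) True by (simp_all add: m_def)
          then show False using nobroom broom by blast
        qed
        then have "weight < 2 + (k - 1)\<^sup>2 + 1"
          using weight_tree_less[OF c(1)] outQ assms(1) nostar c(2) Q(3) by simp
        then show ?thesis using True weightT by simp
      next
        case False
        then have m3: "3 \<le> m" using m1 m2 by simp
        then have "\<not> broom_at u w" if "u \<in> Q" "p w \<in> Q" for u w
          using nobroom that by (simp add: m_def)
        then have "weight < 2 * (m - 1) * k + (k - 1)\<^sup>2 + 1"
          using weight_clique_less m3 outQ assms(1) nostar Q(2) by (simp add: m_def)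
        then show ?thesis using False weightT by simp
      qed
      then show ?thesis
        using S_before_weight[OF GV(1) Q(3,1) TV TE Tr _ n5] Q(2) by simp
    qed
  qed
  ultimately show ?thesis by blast
qed

end
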